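(* Let $q$ be a prime power of the form $q=12c^2+4c+3$ for some integer $c$, and let $n=q^2$. Then there exists a Hadamard matrix of order $4(2n+1)$.
   Context: A Hadamard matrix of order $v$ is a $v\times v$ matrix $H$ with entries $\pm1$ such that $HH^{\top}=vI$. *)

theory Defs
  imports "HOL-Number_Theory.Prime_Powers" "Jordan_Normal_Form.Matrix"
begin

definition hadamard_matrix :: "nat \<Rightarrow> int mat \<Rightarrow> bool" where
  "hadamard_matrix v H \<longleftrightarrow>
     H \<in> carrier_mat v v \<and>
     (\<forall>i<v. \<forall>j<v. H $$ (i, j) = 1 \<or> H $$ (i, j) = -1) \<and>
     H * transpose_mat H = of_nat v \<cdot>\<^sub>m 1\<^sub>m v"

end

theory Submission
  imports
    Defs
    "HOL-Number_Theory.Residues"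
    "HOL-Algebra.Algebraic_Closure"
    "HOL-Algebra.Multiplicative_Group"
begin

text \<open>
  If \<open>q = 12c\<^sup>2 + 4c + 3\<close> then \<open>q \<equiv> 3 (mod 8)\<close>. Let \<open>K\<close> be the field with
  \<open>q\<^sup>2\<close> elements, \<open>F\<close> its subfield with \<open>q\<close> elements and \<open>\<omega>\<close> a generator of the multiplicative group
  of \<open>K\<close>. By a bordered Goethals--Seidel array it suffices to find four \<open>\<plusminus>1\<close>-functions on
  \<open>\<int>/2 \<times> K\<close> with sums 0, 0, 0, 2 whose autocorrelations add up to -4 away from the identity. Write
  the i-th one as \<open>u\<^sub>i \<plusminus> w\<^sub>i\<close> on the two copies of \<open>K\<close>; then the autocorrelations of the \<open>u\<^sub>i\<close> have to
  add up to -2 and those of the \<open>w\<^sub>i\<close> to 0.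

  All functions are sums over the \<open>q + 1\<close> lines of \<open>K\<close> of ridge functions
  \<open>\<alpha>\<^sub>j [Tr (\<omega>\<^sup>j x) = 0] + \<beta>\<^sub>j \<eta> (Tr (\<omega>\<^sup>j x))\<close> with \<open>\<eta>\<close> the quadratic character of \<open>F\<close>. Ridge functions
  of different directions are uncorrelated up to a constant, so the total autocorrelation is constant
  as soon as the total energy \<open>\<alpha>\<^sub>j\<^sup>2 + q \<beta>\<^sub>j\<^sup>2\<close> is the same for all \<open>j\<close>. The coefficients \<open>\<beta>\<^sub>j\<close> are chosen
  so that the odd parts are signed unions of cyclotomic classes of order 8. The numbers
  \<open>\<eta> (Tr (\<omega>\<^sup>k))\<close> form a negacyclic conference matrix; summing them over octic classes gives
  \<open>(a, b, 0, b)\<close> with \<open>a\<^sup>2 + 2b\<^sup>2 = q\<close>, by orthogonality and invariance under \<open>x \<mapsto> x\<^sup>q\<close>, and with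
  these values the energies are equal.
\<close>

section \<open>The bordered Goethals--Seidel array\<close>

text \<open>The set \<open>I\<close> frees later arguments from numbering the rows. Rows of signs
  have squared norm \<open>n\<close> automatically, so only orthogonality is asked for.\<close>

lemma hadamard_matrix_of_orthogonal_rows:
  fixes H :: "'i \<Rightarrow> 'i \<Rightarrow> int"
  assumes I: "finite I" "card I = n"
    and entries: "\<And>i j. i \<in> I \<Longrightarrow> j \<in> I \<Longrightarrow> H i j = 1 \<or> H i j = -1"
    and rows: "\<And>i i'. i \<in> I \<Longrightarrow> i' \<in> I \<Longrightarrow> i \<noteq> i' \<Longrightarrow> (\<Sum>j\<in>I. H i j * H i' j) = 0"
  shows "\<exists>M. hadamard_matrix n M"
proof -
  obtain h where h: "bij_betw h {0..<n} I" using ex_bij_betw_nat_finite[OF I(1)] I(2) by blast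
  then have hI: "h a \<in> I" if "a < n" for a using that by (auto simp: bij_betw_def)
  define M where "M = mat n n (\<lambda>(a, b). H (h a) (h b))"
  have inner: "(\<Sum>k = 0..<n. H (h a) (h k) * H (h b) (h k)) = (if a = b then int n else 0)"
    if ab: "a < n" "b < n" for a b
  proof -
    have "(\<Sum>k = 0..<n. H (h a) (h k) * H (h b) (h k)) = (\<Sum>j\<in>I. H (h a) j * H (h b) j)"
      by (rule sum.reindex_bij_betw[OF h])
    also have "\<dots> = (if a = b then int n else 0)"
    proof (cases "a = b")
      case True
      have "(\<Sum>j\<in>I. H (h a) j * H (h b) j) = (\<Sum>j\<in>I. 1)"
        using True entries[OF hI[OF ab(1)]] by (intro sum.cong refl) force
      then show ?thesis using True I by simp
    next
      case False
      then have "h a \<noteq> h b" using h ab by (auto simp: bij_betw_def inj_on_def)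
      then show ?thesis using False rows hI ab by simp
    qed
    finally show ?thesis .
  qed
  have "hadamard_matrix n M"
    unfolding hadamard_matrix_def
  proof (intro conjI allI impI)
    show "M * transpose_mat M = of_nat n \<cdot>\<^sub>m 1\<^sub>m n"
      by (rule eq_matI) (auto simp: M_def scalar_prod_def inner)
  qed (auto simp: M_def entries hI)
  then show ?thesis ..
qed

section \<open>Autocorrelations and the Goethals-Seidel array over an abelian group\<close>

definition autocorrelation :: "('a, 'b) monoid_scheme \<Rightarrow> ('a \<Rightarrow> 'c :: comm_semiring_0) \<Rightarrow> 'a \<Rightarrow> 'c" where
  "autocorrelation G f s = (\<Sum>z\<in>carrier G. f z * f (z \<otimes>\<^bsub>G\<^esub> s))"

context comm_group
begin

lemma sum_translate:
  assumes "t \<in> carrier G"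
  shows "(\<Sum>y\<in>carrier G. F y) = (\<Sum>z\<in>carrier G. F (z \<otimes> t))"
  by (rule sum.reindex_bij_witness[of _ "\<lambda>z. z \<otimes> t" "\<lambda>y. y \<otimes> inv t"])
     (use assms in \<open>auto simp: m_assoc\<close>)

lemma sum_reflect:
  assumes "t \<in> carrier G"
  shows "(\<Sum>y\<in>carrier G. F y) = (\<Sum>z\<in>carrier G. F (inv z \<otimes> t))"
  by (rule sum.reindex_bij_witness[of _ "\<lambda>z. inv z \<otimes> t" "\<lambda>y. inv y \<otimes> t"])
     (use assms in \<open>auto simp: m_assoc inv_mult m_lcomm\<close>)

lemma mult_cancel_conjugate [simp]:
  assumes "x \<in> carrier G" "z \<in> carrier G"
  shows "inv x \<otimes> (z \<otimes> x) = z" "x \<otimes> (z \<otimes> inv x) = z"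
    "x \<otimes> (inv x \<otimes> z) = z" "inv x \<otimes> (x \<otimes> z) = z"
  using assms by (simp_all add: m_lcomm m_comm[of z] flip: m_assoc)

text \<open>The three kinds of blocks of the Goethals--Seidel array are, in the variables \<open>x\<close> (row)
  and \<open>y\<close> (column), \<open>f (y x\<inverse>)\<close>, \<open>f (x\<inverse> y\<inverse>)\<close> and \<open>f (x y)\<close>. Rows of different block rows
  are orthogonal because the mixed correlations below cancel in pairs.\<close>

lemma mixed_correlations:
  fixes f h :: "'a \<Rightarrow> int"
  assumes x: "x \<in> carrier G" "x' \<in> carrier G"
  shows "(\<Sum>y\<in>carrier G. f (y \<otimes> inv x) * h (inv x' \<otimes> inv y))
       = (\<Sum>y\<in>carrier G. f (y \<otimes> inv x') * h (inv x \<otimes> inv y))"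
    and "(\<Sum>y\<in>carrier G. f (y \<otimes> inv x) * h (x' \<otimes> y))
       = (\<Sum>y\<in>carrier G. f (y \<otimes> inv x') * h (x \<otimes> y))"
    and "(\<Sum>y\<in>carrier G. f (inv x \<otimes> inv y) * h (x' \<otimes> y))
       = (\<Sum>y\<in>carrier G. f (x' \<otimes> y) * h (inv x \<otimes> inv y))"
    and "(\<Sum>y\<in>carrier G. f (inv x \<otimes> inv y) * h (inv x' \<otimes> inv y))
       = (\<Sum>y\<in>carrier G. f (x' \<otimes> y) * h (x \<otimes> y))"
  subgoal
    \<comment> \<open>Put \<open>y = z \<otimes> x\<close> on the left and
      \<open>y = z \<otimes> x'\<close> on the right, so that both summands contain
      \<open>f z\<close>.\<close>
    apply (subst sum_translate[OF x(1)], subst (2) sum_translate[OF x(2)])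
    using x by (intro sum.cong) (auto simp: m_assoc inv_mult m_comm m_lcomm)
  subgoal
    apply (subst sum_translate[OF x(1)], subst (2) sum_translate[OF x(2)])
    using x by (intro sum.cong) (auto simp: m_assoc inv_mult m_comm m_lcomm)
  subgoal
    apply (subst sum_reflect[OF inv_closed[OF x(1)]], subst (2) sum_translate[OF inv_closed[OF x(2)]])
    using x by (intro sum.cong) (auto simp: m_assoc inv_mult m_comm m_lcomm)
  subgoal
    apply (subst sum_reflect[OF inv_closed[OF x(1)]], subst (2) sum_translate[OF inv_closed[OF x(2)]])
    using x by (intro sum.cong) (auto simp: m_assoc inv_mult m_comm m_lcomm)
  done

text \<open>Serves two rows of the same block row: for every kind of block only the quotient of
  \<open>x\<close> and \<open>x'\<close> matters.\<close>

lemma self_correlations: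
  fixes f :: "'a \<Rightarrow> int"
  assumes x: "x \<in> carrier G" "x' \<in> carrier G"
  shows "(\<Sum>y\<in>carrier G. f (y \<otimes> inv x) * f (y \<otimes> inv x')) = autocorrelation G f (x \<otimes> inv x')"
    and "(\<Sum>y\<in>carrier G. f (inv x \<otimes> inv y) * f (inv x' \<otimes> inv y)) = autocorrelation G f (x \<otimes> inv x')"
    and "(\<Sum>y\<in>carrier G. f (x \<otimes> y) * f (x' \<otimes> y)) = autocorrelation G f (x \<otimes> inv x')"
  unfolding autocorrelation_def
  subgoal
    apply (subst sum_translate[OF x(1)])
    using x by (intro sum.cong) (auto simp: m_assoc)
  subgoal
    apply (subst sum_reflect[OF inv_closed[OF x(1)]])
    using x by (intro sum.cong) (auto simp: m_assoc inv_mult m_comm m_lcomm)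
  subgoal
    apply (subst sum_translate[OF inv_closed[OF x(2)]])
    using x by (intro sum.cong) (auto simp: m_assoc m_comm m_lcomm)
  done


text \<open>With \<open>R\<close> the permutation matrix of inversion, the entries at
  \<open>M\<close> belong to \<open>B R\<close> and those at \<open>P\<close> to the transpose of
  \<open>B\<close> times \<open>R\<close>, as in the classical array.\<close>

definition goethals_seidel ::
  "('a \<Rightarrow> int) \<Rightarrow> ('a \<Rightarrow> int) \<Rightarrow> ('a \<Rightarrow> int) \<Rightarrow> ('a \<Rightarrow> int) \<Rightarrow> nat \<Rightarrow> nat \<Rightarrow> 'a \<Rightarrow> 'a \<Rightarrow> int" where
  "goethals_seidel a b c d i j x y =
     (let \<Gamma> = y \<otimes> inv x; M = inv x \<otimes> inv y; P = x \<otimes> y in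
      [[a \<Gamma>, b M, c M, d M],
       [- b M, a \<Gamma>, d P, - c P],
       [- c M, - d P, a \<Gamma>, b P],
       [- d M, c P, - b P, a \<Gamma>]] ! i ! j)"

text \<open>For distinct block rows the four products cancel in pairs: against block row 0 by the
  first and third mixed identities, among block rows 1, 2, 3 by the second and fourth.\<close>

lemma goethals_seidel_rows:
  assumes x: "x \<in> carrier G" "x' \<in> carrier G" and i: "i < 4" "i' < 4"
  shows "(\<Sum>j<4. \<Sum>y\<in>carrier G. goethals_seidel a b c d i j x y * goethals_seidel a b c d i' j x' y)
    = (if i = i' then autocorrelation G a (x \<otimes> inv x') + autocorrelation G b (x \<otimes> inv x')
        + autocorrelation G c (x \<otimes> inv x') + autocorrelation G d (x \<otimes> inv x') else 0)"
proof -
  have i: "i \<in> {0, 1, 2, 3}" "i' \<in> {0, 1, 2, 3}" using i by auto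
  note self = self_correlations[OF x]
  note mixed = mixed_correlations[OF x]
  note expand = goethals_seidel_def lessThan_nat_numeral Let_def sum_negf mult.commute
  show ?thesis
  proof (cases "i = i'")
    case True
    then show ?thesis using i
      by (auto simp: goethals_seidel_def lessThan_nat_numeral Let_def self)
  next
    case False
    then consider "i = 0" "i' = 1" | "i = 0" "i' = 2" | "i = 0" "i' = 3"
      | "i = 1" "i' = 0" | "i = 1" "i' = 2" | "i = 1" "i' = 3"
      | "i = 2" "i' = 0" | "i = 2" "i' = 1" | "i = 2" "i' = 3"
      | "i = 3" "i' = 0" | "i = 3" "i' = 1" | "i = 3" "i' = 2"
      using i by auto
    then show ?thesis
    proof cases
      case 1 then show ?thesis using mixed(1)[of a b] mixed(3)[of c d] by (simp add: expand)
    next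
      case 2 then show ?thesis using mixed(1)[of a c] mixed(3)[of b d] by (simp add: expand)
    next
      case 3 then show ?thesis using mixed(1)[of a d] mixed(3)[of b c] by (simp add: expand)
    next
      case 4 then show ?thesis using mixed(1)[of a b] mixed_correlations(3)[OF x(2,1), of c d] by (simp add: expand)
    next
      case 5 then show ?thesis using mixed(2)[of a d] mixed(4)[of b c] by (simp add: expand)
    next
      case 6 then show ?thesis using mixed(2)[of a c] mixed(4)[of b d] by (simp add: expand)
    next
      case 7 then show ?thesis using mixed(1)[of a c] mixed_correlations(3)[OF x(2,1), of b d] by (simp add: expand)
    next
      case 8 then show ?thesis using mixed(2)[of a d] mixed(4)[of c b] by (simp add: expand)
    next
      case 9 then show ?thesis using mixed(2)[of a b] mixed(4)[of c d] by (simp add: expand)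
    next
      case 10 then show ?thesis using mixed(1)[of a d] mixed_correlations(3)[OF x(2,1), of b c] by (simp add: expand)
    next
      case 11 then show ?thesis using mixed(2)[of a c] mixed(4)[of d b] by (simp add: expand)
    next
      case 12 then show ?thesis using mixed(2)[of a b] mixed(4)[of d c] by (simp add: expand)
    qed
  qed
qed

text \<open>Needed for the border, which is constant along each block. Every row of a block
  rearranges one function, so the blocks of \<open>b\<close>, \<open>c\<close>, \<open>d\<close>
  disappear.\<close>

lemma goethals_seidel_sum:
  assumes x: "x \<in> carrier G" and ij: "i < 4" "j < 4"
    and zero: "(\<Sum>y\<in>carrier G. b y) = 0" "(\<Sum>y\<in>carrier G. c y) = 0" "(\<Sum>y\<in>carrier G. d y) = 0"
  shows "(\<Sum>y\<in>carrier G. goethals_seidel a b c d i j x y) = (if i = j then (\<Sum>y\<in>carrier G. a y) else 0)"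
proof -
  have "(\<Sum>y\<in>carrier G. f (y \<otimes> inv x)) = (\<Sum>y\<in>carrier G. f y)"
    "(\<Sum>y\<in>carrier G. f (inv x \<otimes> inv y)) = (\<Sum>y\<in>carrier G. f y)"
    "(\<Sum>y\<in>carrier G. f (x \<otimes> y)) = (\<Sum>y\<in>carrier G. f y)" for f :: "'a \<Rightarrow> int"
    using sum_translate[of "inv x" f] sum_reflect[of "inv x" f] sum_translate[of x f] x
    by (simp_all add: m_comm cong: sum.cong)
  moreover have "i \<in> {0, 1, 2, 3}" "j \<in> {0, 1, 2, 3}" using ij by auto
  ultimately show ?thesis
    by (auto simp: goethals_seidel_def Let_def sum_negf zero)
qed

text \<open>The border: with \<open>S\<close> the Sylvester matrix of order 4, the corner is \<open>J - 2 I\<close>, the left border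
  is \<open>S\<close> and the top border is \<open>S\<close> with its first column negated, which is \<open>- (J - 2 I) S\<^sup>T / 2\<close>.\<close>

definition sylvester4 :: "nat \<Rightarrow> nat \<Rightarrow> int" where
  "sylvester4 i j = [[1, 1, 1, 1], [1, -1, 1, -1], [1, 1, -1, -1], [1, -1, -1, 1]] ! i ! j"

definition bordered_goethals_seidel ::
  "('a \<Rightarrow> int) \<Rightarrow> ('a \<Rightarrow> int) \<Rightarrow> ('a \<Rightarrow> int) \<Rightarrow> ('a \<Rightarrow> int)
    \<Rightarrow> nat \<times> 'a option \<Rightarrow> nat \<times> 'a option \<Rightarrow> int" where
  "bordered_goethals_seidel a b c d r s =
     (case (r, s) of
        ((i, None), (j, None)) \<Rightarrow> (if i = j then -1 else 1)
      | ((i, None), (j, Some y)) \<Rightarrow> (if j = 0 then - sylvester4 i j else sylvester4 i j)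
      | ((i, Some x), (j, None)) \<Rightarrow> sylvester4 i j
      | ((i, Some x), (j, Some y)) \<Rightarrow> goethals_seidel a b c d i j x y)"

text \<open>Two rows of one block row get 4 from the left border, which the total autocorrelation -4
  cancels; for different block rows the Sylvester rows are orthogonal.\<close>

theorem hadamard_matrix_of_four_functions:
  fixes a b c d :: "'a \<Rightarrow> int"
  assumes fin: "finite (carrier G)"
    and pm: "\<And>x. x \<in> carrier G \<Longrightarrow> \<bar>a x\<bar> = 1" "\<And>x. x \<in> carrier G \<Longrightarrow> \<bar>b x\<bar> = 1"
      "\<And>x. x \<in> carrier G \<Longrightarrow> \<bar>c x\<bar> = 1" "\<And>x. x \<in> carrier G \<Longrightarrow> \<bar>d x\<bar> = 1"
    and sums: "(\<Sum>y\<in>carrier G. a y) = 2" "(\<Sum>y\<in>carrier G. b y) = 0"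
      "(\<Sum>y\<in>carrier G. c y) = 0" "(\<Sum>y\<in>carrier G. d y) = 0"
    and corr: "\<And>s. s \<in> carrier G \<Longrightarrow> s \<noteq> \<one> \<Longrightarrow> autocorrelation G a s + autocorrelation G b s
      + autocorrelation G c s + autocorrelation G d s = -4"
  shows "\<exists>M. hadamard_matrix (4 * (card (carrier G) + 1)) M"
proof -
  define I where "I = {..<4::nat} \<times> insert None (Some ` carrier G)"
  let ?H = "bordered_goethals_seidel a b c d"
  show ?thesis
  proof (rule hadamard_matrix_of_orthogonal_rows[of I _ ?H])
    show "finite I" using fin by (simp add: I_def)
    show "card I = 4 * (card (carrier G) + 1)"
      unfolding I_def using fin by (simp add: card_cartesian_product card_image)
    have four: "i \<in> {0, 1, 2, 3}" if "i < 4" for i :: nat using that by auto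
    have gs_pm: "\<bar>goethals_seidel a b c d i j x y\<bar> = 1"
      if "i < 4" "j < 4" "x \<in> carrier G" "y \<in> carrier G" for i j x y
      using four[OF that(1)] four[OF that(2)] that(3,4) pm
      by (elim insertE) (simp_all add: goethals_seidel_def Let_def)
    have sylv_pm: "\<bar>sylvester4 i j\<bar> = 1" if "i < 4" "j < 4" for i j
      using four[OF that(1)] four[OF that(2)] by (auto simp: sylvester4_def)
    show "?H r s = 1 \<or> ?H r s = -1" if "r \<in> I" "s \<in> I" for r s
    proof -
      have "\<bar>?H r s\<bar> = 1"
        using that gs_pm sylv_pm by (auto simp: I_def bordered_goethals_seidel_def)
      then show ?thesis by arith
    qed
    have split: "(\<Sum>s\<in>I. F s) = (\<Sum>j<4. F (j, None)) + (\<Sum>j<4. \<Sum>y\<in>carrier G. F (j, Some y))"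
      for F :: "nat \<times> 'a option \<Rightarrow> int"
    proof -
      have "(\<Sum>s\<in>I. F s) = (\<Sum>j<4. \<Sum>t\<in>insert None (Some ` carrier G). F (j, t))"
        unfolding I_def by (simp add: sum.cartesian_product)
      also have "\<dots> = (\<Sum>j<4. F (j, None) + (\<Sum>y\<in>carrier G. F (j, Some y)))"
        using fin by (intro sum.cong) (auto simp: sum.reindex)
      finally show ?thesis by (simp add: sum.distrib)
    qed
    show "(\<Sum>s\<in>I. ?H r s * ?H r' s) = 0" if rr: "r \<in> I" "r' \<in> I" "r \<noteq> r'" for r r'
    proof -
      obtain i t i' t' where r: "r = (i, t)" "r' = (i', t')" by (cases r, cases r') auto
      have i: "i < 4" "i' < 4" using rr r by (auto simp: I_def)
      note i4 = four[OF i(1)] four[OF i(2)]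
      \<comment> \<open>The top border only meets row sums of the array, of which just block
        \<open>i'\<close> is nonzero, with value 2. So \<open>(J - 2 I) S^T\<close> plus twice the
        top border has to vanish.\<close>
      have border_None: "(\<Sum>s\<in>I. ?H (i, None) s * ?H (i', Some x) s) = 0"
        if "i < 4" "i' < 4" "x \<in> carrier G" for i i' x
      proof -
        have "(\<Sum>s\<in>I. ?H (i, None) s * ?H (i', Some x) s)
          = (\<Sum>j<4. (if i = j then -1 else 1) * sylvester4 i' j)
            + (\<Sum>j<4. (if j = 0 then - sylvester4 i j else sylvester4 i j)
                * (\<Sum>y\<in>carrier G. goethals_seidel a b c d i' j x y))"
          by (simp add: split bordered_goethals_seidel_def sum_distrib_left)
        also have "(\<Sum>j<4. (if j = 0 then - sylvester4 i j else sylvester4 i j)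
                * (\<Sum>y\<in>carrier G. goethals_seidel a b c d i' j x y))
            = (\<Sum>j<4. (if j = 0 then - sylvester4 i j else sylvester4 i j) * (if i' = j then 2 else 0))"
          using that sums by (intro sum.cong refl) (simp add: goethals_seidel_sum)
        also have "(\<Sum>j<4. (if i = j then -1 else 1) * sylvester4 i' j) + \<dots> = 0"
          using four[OF that(1)] four[OF that(2)]
          by (elim insertE) (simp_all add: sylvester4_def lessThan_nat_numeral)
        finally show ?thesis .
      qed
      show ?thesis
      proof (cases t; cases t')
        assume t: "t = None" "t' = None"
        have "i \<noteq> i'" using rr r t by auto
        \<comment> \<open>Both \<open>J - 2 I\<close> and the top border have pairwise orthogonal
          rows.\<close>
        then show ?thesis using i4 unfolding r t split
          by (elim insertE) (simp_all add: bordered_goethals_seidel_def lessThan_nat_numeral sylvester4_def)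
      next
        fix x assume t: "t = None" "t' = Some x"
        then have "x \<in> carrier G" using rr r by (auto simp: I_def)
        then show ?thesis unfolding r t using border_None i by blast
      next
        fix x assume t: "t = Some x" "t' = None"
        then have "x \<in> carrier G" using rr r by (auto simp: I_def)
        then show ?thesis unfolding r t using border_None[OF i(2,1)] by (simp add: mult.commute)
      next
        fix x x' assume t: "t = Some x" "t' = Some x'"
        then have x: "x \<in> carrier G" "x' \<in> carrier G" using rr r by (auto simp: I_def)
        have "(\<Sum>s\<in>I. ?H r s * ?H r' s) = (\<Sum>j<4. sylvester4 i j * sylvester4 i' j)
          + (\<Sum>j<4. \<Sum>y\<in>carrier G. goethals_seidel a b c d i j x y * goethals_seidel a b c d i' j x' y)"
          unfolding r t by (simp add: split bordered_goethals_seidel_def)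
        also have "(\<Sum>j<4. sylvester4 i j * sylvester4 i' j) = (if i = i' then 4 else 0)"
          using i4 by (elim insertE) (simp_all add: lessThan_nat_numeral sylvester4_def)
        finally have eq: "(\<Sum>s\<in>I. ?H r s * ?H r' s) = (if i = i' then 4 else 0)
          + (\<Sum>j<4. \<Sum>y\<in>carrier G. goethals_seidel a b c d i j x y * goethals_seidel a b c d i' j x' y)" .
        show ?thesis
        proof (cases "i = i'")
          case True
          then have "x \<noteq> x'" using rr r t by auto
          then have "x \<otimes> inv x' \<noteq> \<one>" using x by (metis inv_equality inv_inv inv_closed)
          then show ?thesis
            using corr[of "x \<otimes> inv x'"] x True unfolding eq goethals_seidel_rows[OF x i] by simp
        qed (simp add: eq goethals_seidel_rows[OF x i])
      qed
    qed
  qed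
qed

end

section \<open>Existence of finite fields\<close>

lemma (in cring) binomial_theorem:
  assumes [simp]: "x \<in> carrier R" "y \<in> carrier R"
  shows "(x \<oplus> y) [^] n = (\<Oplus>k\<in>{..n}. [(n choose k)] \<cdot> (x [^] k \<otimes> y [^] (n - k)))"
proof (induction n)
  case (Suc n)
  let ?t = "\<lambda>m k. [(n choose k)] \<cdot> (x [^] k \<otimes> y [^] (m - k))"
  let ?u = "\<lambda>k. [(n choose k)] \<cdot> (x [^] Suc k \<otimes> y [^] (n - k))"
  have closed: "?t m k \<in> carrier R" "?u k \<in> carrier R" for m k by simp_all
  have "(x \<oplus> y) [^] Suc n = (\<Oplus>k\<in>{..n}. ?t n k) \<otimes> (x \<oplus> y)" using Suc by simp
  also have "\<dots> = (\<Oplus>k\<in>{..n}. ?t n k) \<otimes> x \<oplus> (\<Oplus>k\<in>{..n}. ?t n k) \<otimes> y"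
    by (intro r_distr finsum_closed) (auto simp: Pi_def)
  also have "(\<Oplus>k\<in>{..n}. ?t n k) \<otimes> x = (\<Oplus>k\<in>{..n}. ?u k)"
    by (subst finsum_ldistr)
       (auto simp: Pi_def add_pow_ldistr add_pow_rdistr m_ac intro!: finsum_cong' )
  also have "(\<Oplus>k\<in>{..n}. ?t n k) \<otimes> y = (\<Oplus>k\<in>{..n}. ?t (Suc n) k)"
    by (subst finsum_ldistr)
       (auto simp: Pi_def add_pow_ldistr m_assoc Suc_diff_le intro!: finsum_cong')
  \<comment> \<open>The added term has coefficient \<open>n choose Suc n = 0\<close>; it aligns the
    two sums for Pascal's rule.\<close>
  also have "\<dots> = (\<Oplus>k\<in>{..Suc n}. ?t (Suc n) k)"
    by (subst finsum_Suc) (auto simp: Pi_def binomial_eq_0)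
  also have "\<dots> = (\<Oplus>k\<in>{..n}. ?t (Suc n) (Suc k)) \<oplus> y [^] Suc n"
    by (subst finsum_Suc2) (auto simp: Pi_def)
  also have "(\<Oplus>k\<in>{..n}. ?u k) \<oplus> ((\<Oplus>k\<in>{..n}. ?t (Suc n) (Suc k)) \<oplus> y [^] Suc n)
      = (\<Oplus>k\<in>{..n}. ?u k \<oplus> ?t (Suc n) (Suc k)) \<oplus> y [^] Suc n"
    by (subst finsum_addf) (auto simp: Pi_def a_assoc)
  also have "\<dots> = (\<Oplus>k\<in>{..n}. [(Suc n choose Suc k)] \<cdot> (x [^] Suc k \<otimes> y [^] (Suc n - Suc k))) \<oplus> y [^] Suc n"
    by (intro arg_cong2[where f = "(\<oplus>)"] finsum_cong') (auto simp: Pi_def add.nat_pow_mult)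
  also have "\<dots> = (\<Oplus>k\<in>{..Suc n}. [(Suc n choose k)] \<cdot> (x [^] k \<otimes> y [^] (Suc n - k)))"
    by (subst finsum_Suc2) (auto simp: Pi_def)
  finally show ?case .
qed simp

lemma (in cring) add_pow_char_dvd:
  assumes char: "[p] \<cdot> \<one> = \<zero>" and "p dvd n" "z \<in> carrier R"
  shows "[(n::nat)] \<cdot> z = \<zero>"
proof -
  obtain m where m: "n = p * m" using assms by auto
  have "[n] \<cdot> z = ([n] \<cdot> \<one>) \<otimes> z" using assms by (simp add: add_pow_ldistr)
  also have "[n] \<cdot> \<one> = [m] \<cdot> ([p] \<cdot> \<one>)" unfolding m by (simp add: add.nat_pow_pow)
  also have "\<dots> = \<zero>" using char by simp
  finally show ?thesis using assms by simp
qed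

text \<open>The prime \<open>p\<close> divides all inner binomial coefficients, so only the outer
  terms survive; then iterate.\<close>

lemma (in cring) frobenius_add:
  assumes p: "Factorial_Ring.prime (p::nat)" and char: "[p] \<cdot> \<one> = \<zero>"
    and xy: "x \<in> carrier R" "y \<in> carrier R"
  shows "(x \<oplus> y) [^] (p ^ j) = x [^] (p ^ j) \<oplus> y [^] (p ^ j)"
  using xy
proof (induction j arbitrary: x y)
  case (Suc j)
  have step: "(x \<oplus> y) [^] p = x [^] p \<oplus> y [^] p" if xy: "x \<in> carrier R" "y \<in> carrier R" for x y
  proof -
    obtain n where n: "p = Suc (Suc n)"
      using prime_ge_2_nat[OF p] by (metis Suc_le_D numeral_2_eq_2 Suc_le_mono)
    let ?f = "\<lambda>k. [(p choose k)] \<cdot> (x [^] k \<otimes> y [^] (p - k))"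
    have zero: "?f (Suc k) = \<zero>" if "k \<le> n" for k
      using that xy p n by (intro add_pow_char_dvd[OF char] dvd_choose_prime) auto
    have "(x \<oplus> y) [^] p = (\<Oplus>k\<in>{..Suc (Suc n)}. ?f k)" using binomial_theorem[OF xy, of p] n by simp
    also have "\<dots> = ?f p \<oplus> ((\<Oplus>k\<in>{..n}. ?f (Suc k)) \<oplus> ?f 0)"
      using xy n by (subst finsum_Suc, simp add: Pi_def, subst finsum_Suc2) (auto simp: Pi_def)
    also have "(\<Oplus>k\<in>{..n}. ?f (Suc k)) = \<zero>"
      using zero by (intro add.finprod_one_eqI) simp
    finally show ?thesis using xy by simp
  qed
  have "(x \<oplus> y) [^] (p ^ Suc j) = ((x \<oplus> y) [^] (p ^ j)) [^] p"
    using Suc.prems by (simp add: nat_pow_pow mult.commute)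
  also have "\<dots> = (x [^] (p ^ j)) [^] p \<oplus> (y [^] (p ^ j)) [^] p"
    using Suc by (simp add: step)
  finally show ?case using Suc.prems by (simp add: nat_pow_pow mult.commute)
qed simp

text \<open>Takes the place of a derivative: the cofactor \<open>s\<close> is the sum of all
  \<open>c^i z^(n-i)\<close>, and \<open>h\<close> sends both \<open>z\<close> and \<open>c\<close>
  to \<open>r\<close>.\<close>

lemma (in ring_hom_cring) pow_factor:
  assumes z: "z \<in> carrier R" and c: "c \<in> carrier R" and h: "h z = r" "h c = r"
  shows "\<exists>s\<in>carrier R. z [^]\<^bsub>R\<^esub> Suc n = c [^]\<^bsub>R\<^esub> Suc n \<oplus>\<^bsub>R\<^esub> (z \<ominus>\<^bsub>R\<^esub> c) \<otimes>\<^bsub>R\<^esub> s \<and> h s = [(Suc n)] \<cdot>\<^bsub>S\<^esub> (r [^]\<^bsub>S\<^esub> n)"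
proof (induction n)
  case 0
  have "z = c \<oplus>\<^bsub>R\<^esub> (z \<ominus>\<^bsub>R\<^esub> c)" using z c by algebra
  then show ?case using z c by (intro bexI[of _ "\<one>\<^bsub>R\<^esub>"]) auto
next
  case (Suc n)
  then obtain s where s: "s \<in> carrier R" "h s = [(Suc n)] \<cdot>\<^bsub>S\<^esub> (r [^]\<^bsub>S\<^esub> n)"
    and eq: "z [^]\<^bsub>R\<^esub> Suc n = c [^]\<^bsub>R\<^esub> Suc n \<oplus>\<^bsub>R\<^esub> (z \<ominus>\<^bsub>R\<^esub> c) \<otimes>\<^bsub>R\<^esub> s" by blast
  have r: "r \<in> carrier S" using h z by auto
  show ?case
  proof (intro bexI[of _ "c [^]\<^bsub>R\<^esub> Suc n \<oplus>\<^bsub>R\<^esub> s \<otimes>\<^bsub>R\<^esub> z"] conjI)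
    have "z [^]\<^bsub>R\<^esub> Suc (Suc n) = (c [^]\<^bsub>R\<^esub> Suc n \<oplus>\<^bsub>R\<^esub> (z \<ominus>\<^bsub>R\<^esub> c) \<otimes>\<^bsub>R\<^esub> s) \<otimes>\<^bsub>R\<^esub> z"
      using eq by simp
    moreover have "c [^]\<^bsub>R\<^esub> Suc (Suc n) = c [^]\<^bsub>R\<^esub> Suc n \<otimes>\<^bsub>R\<^esub> c" by simp
    moreover have "(d \<oplus>\<^bsub>R\<^esub> (z \<ominus>\<^bsub>R\<^esub> c) \<otimes>\<^bsub>R\<^esub> s) \<otimes>\<^bsub>R\<^esub> z
        = d \<otimes>\<^bsub>R\<^esub> c \<oplus>\<^bsub>R\<^esub> (z \<ominus>\<^bsub>R\<^esub> c) \<otimes>\<^bsub>R\<^esub> (d \<oplus>\<^bsub>R\<^esub> s \<otimes>\<^bsub>R\<^esub> z)" if "d \<in> carrier R" for d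
      using that z c s by algebra
    ultimately show "z [^]\<^bsub>R\<^esub> Suc (Suc n) = c [^]\<^bsub>R\<^esub> Suc (Suc n)
        \<oplus>\<^bsub>R\<^esub> (z \<ominus>\<^bsub>R\<^esub> c) \<otimes>\<^bsub>R\<^esub> (c [^]\<^bsub>R\<^esub> Suc n \<oplus>\<^bsub>R\<^esub> s \<otimes>\<^bsub>R\<^esub> z)"
      using c by simp
    have "h (c [^]\<^bsub>R\<^esub> Suc n \<oplus>\<^bsub>R\<^esub> s \<otimes>\<^bsub>R\<^esub> z) = r [^]\<^bsub>S\<^esub> Suc n \<oplus>\<^bsub>S\<^esub> ([(Suc n)] \<cdot>\<^bsub>S\<^esub> (r [^]\<^bsub>S\<^esub> n)) \<otimes>\<^bsub>S\<^esub> r"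
      using z c s h by (simp del: nat_pow_Suc)
    also have "([(Suc n)] \<cdot>\<^bsub>S\<^esub> (r [^]\<^bsub>S\<^esub> n)) \<otimes>\<^bsub>S\<^esub> r = [(Suc n)] \<cdot>\<^bsub>S\<^esub> (r [^]\<^bsub>S\<^esub> Suc n)"
      using r by (simp add: S.add_pow_ldistr S.l_distr)
    finally show "h (c [^]\<^bsub>R\<^esub> Suc n \<oplus>\<^bsub>R\<^esub> s \<otimes>\<^bsub>R\<^esub> z) = [(Suc (Suc n))] \<cdot>\<^bsub>S\<^esub> (r [^]\<^bsub>S\<^esub> Suc n)"
      using r by (simp add: S.add.m_comm)
  qed (use z c s in auto)
qed

text \<open>The polynomial \<open>X^Q - X\<close> has \<open>Q\<close> roots with multiplicity, and
  all of them are simple.\<close>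

lemma (in algebraically_closed) card_frobenius_fixed:
  assumes p: "Factorial_Ring.prime (p::nat)" and char: "[p] \<cdot> \<one> = \<zero>" and k: "k > 0"
  shows "card {x \<in> carrier L. x [^] (p ^ k) = x} = p ^ k"
proof -
  define Q where "Q = p ^ k"
  have Q: "Q > 1" unfolding Q_def using prime_gt_1_nat[OF p] k by (rule one_less_power)
  let ?A = "poly_ring L"
  interpret UP: domain ?A using univ_poly_is_domain[OF carrier_is_subring] .
  have X: "X \<in> carrier ?A" using var_closed(1)[OF carrier_is_subring] .
  define P where "P = X [^]\<^bsub>?A\<^esub> Q \<ominus>\<^bsub>?A\<^esub> X"
  have P: "P \<in> carrier ?A" unfolding P_def using X by simp
  have degree: "degree P = Q"
  proof -
    have "P = poly_add (monom \<one> Q) (\<ominus>\<^bsub>?A\<^esub> X)"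
      unfolding P_def a_minus_def univ_poly_add unitary_monom_eq_var_pow[OF carrier_is_subring] ..
    moreover have "degree (poly_add (monom \<one> Q) (\<ominus>\<^bsub>?A\<^esub> X)) = max Q 1"
    proof (subst poly_add_degree_eq[OF carrier_is_subring])
      show "polynomial (carrier L) (monom \<one> Q)"
        using monom_is_polynomial[OF carrier_is_subring] by simp
      show "polynomial (carrier L) (\<ominus>\<^bsub>?A\<^esub> X)"
        using UP.a_inv_closed[OF X] by (simp add: univ_poly_carrier)
      have "degree (\<ominus>\<^bsub>?A\<^esub> X) = 1"
        using univ_poly_a_inv_degree[OF carrier_is_subring X] by (simp add: var_def)
      moreover have "degree (monom \<one> Q) = Q" by (simp add: monom_def)
      ultimately show "degree (monom \<one> Q) \<noteq> degree (\<ominus>\<^bsub>?A\<^esub> X)"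
        "max (degree (monom \<one> Q)) (degree (\<ominus>\<^bsub>?A\<^esub> X)) = max Q 1" using Q by simp_all
    qed
    ultimately show ?thesis using Q by simp
  qed
  then have P0: "P \<noteq> []" using Q by auto
  have ev: "ring_hom_cring ?A L (\<lambda>f. eval f r)" if r: "r \<in> carrier L" for r
    using eval_is_hom[OF carrier_is_subring r]
    by (intro ring_hom_cring.intro ring_hom_cring_axioms.intro UP.cring_axioms cring_axioms)
  have root_iff: "is_root P r \<longleftrightarrow> r \<in> carrier L \<and> r [^] Q = r" for r
  proof (cases "r \<in> carrier L")
    case True
    interpret ev: ring_hom_cring ?A L "\<lambda>f. eval f r" using ev[OF True] .
    have "eval P r = r [^] Q \<ominus> r"
      unfolding P_def using X True by (simp add: a_minus_def eval_var)
    then show ?thesis using True P0 by (simp add: is_root_def)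
  qed (simp add: is_root_def)
  \<comment> \<open>\<open>X\<^sup>Q - X = (X - r) (s - 1)\<close> with \<open>s (r) = Q r\<^bsup>Q-1\<^esup> = 0\<close>, so every root \<open>r\<close> is simple.\<close>
  have simple: "alg_mult P r \<le> 1" if root: "is_root P r" for r
  proof (rule ccontr)
    assume "\<not> alg_mult P r \<le> 1"
    then have two: "2 \<le> alg_mult P r" by simp
    have r: "r \<in> carrier L" "r [^] Q = r" using root root_iff by auto
    interpret ev: ring_hom_cring ?A L "\<lambda>f. eval f r" using ev[OF r(1)] .
    interpret const: ring_hom_ring L ?A poly_of_const
      using canonical_embedding_ring_hom[OF carrier_is_subring] by simp
    define C where "C = poly_of_const r"
    define D where "D = [\<one>, \<ominus> r]"
    have C: "C \<in> carrier ?A" unfolding C_def using r by simp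
    have D: "D \<in> carrier ?A"
      using r by (simp add: D_def polynomial_def flip: univ_poly_carrier)
    have X_eq: "X = D \<oplus>\<^bsub>?A\<^esub> C"
      using r by (simp add: univ_poly_add D_def C_def poly_of_const_def var_def l_neg)
    then have D_eq: "D = X \<ominus>\<^bsub>?A\<^esub> C" using C D by (simp add: a_minus_def UP.a_assoc UP.r_neg)
    have evC: "eval C r = r" using r by (simp add: C_def poly_of_const_def)
    obtain s where s: "s \<in> carrier ?A" "eval s r = [(Suc (Q - 1))] \<cdot> (r [^] (Q - 1))"
      "X [^]\<^bsub>?A\<^esub> Suc (Q - 1) = C [^]\<^bsub>?A\<^esub> Suc (Q - 1) \<oplus>\<^bsub>?A\<^esub> (X \<ominus>\<^bsub>?A\<^esub> C) \<otimes>\<^bsub>?A\<^esub> s"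
      using ev.pow_factor[OF X C eval_var[OF r(1)] evC] by blast
    have Suc_Q: "Suc (Q - 1) = Q" using Q by simp
    have "C [^]\<^bsub>?A\<^esub> Q = C"
      unfolding C_def using r const.hom_nat_pow[of r Q] by simp
    then have "P = (C \<oplus>\<^bsub>?A\<^esub> D \<otimes>\<^bsub>?A\<^esub> s) \<ominus>\<^bsub>?A\<^esub> X"
      unfolding P_def using s(3) unfolding Suc_Q D_eq by simp
    then have P_eq: "P = D \<otimes>\<^bsub>?A\<^esub> (s \<ominus>\<^bsub>?A\<^esub> \<one>\<^bsub>?A\<^esub>)"
      unfolding X_eq using C D s(1) UP.r_one[OF D] by algebra
    \<comment> \<open>At a double root one factor \<open>X - r\<close> can be cancelled from both
      factorisations of \<open>P\<close>; evaluating at \<open>r\<close> then gives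
      \<open>0 = s(r) - 1 = -1\<close>.\<close>
    have "D [^]\<^bsub>?A\<^esub> (2::nat) pdivides P"
      using le_alg_mult_imp_pdivides[OF r(1) P two] by (simp add: D_def)
    then obtain h where h: "h \<in> carrier ?A" "P = D [^]\<^bsub>?A\<^esub> (2::nat) \<otimes>\<^bsub>?A\<^esub> h"
      unfolding pdivides_def factor_def by auto
    have "D \<otimes>\<^bsub>?A\<^esub> (D \<otimes>\<^bsub>?A\<^esub> h) = D \<otimes>\<^bsub>?A\<^esub> (s \<ominus>\<^bsub>?A\<^esub> \<one>\<^bsub>?A\<^esub>)"
      using h D P_eq by (simp add: numeral_2_eq_2 UP.m_assoc)
    moreover have "D \<noteq> \<zero>\<^bsub>?A\<^esub>" by (simp add: D_def univ_poly_zero)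
    ultimately have "D \<otimes>\<^bsub>?A\<^esub> h = s \<ominus>\<^bsub>?A\<^esub> \<one>\<^bsub>?A\<^esub>"
      using UP.m_lcancel[OF _ D] D h s(1) by simp
    then have "eval D r \<otimes> eval h r = eval s r \<ominus> \<one>"
      using ev.hom_mult[OF D h(1)] s(1) ev.hom_one by (simp add: a_minus_def)
    moreover have "eval D r = \<zero>" using r by (simp add: D_def r_neg)
    moreover have "eval s r = \<zero>"
      unfolding s(2) Suc_Q using r k
      by (intro add_pow_char_dvd[OF char]) (auto simp: Q_def)
    ultimately have eq: "\<ominus> \<one> = \<zero>"
      using ev.hom_closed[OF h(1)] by (simp add: a_minus_def)
    have "\<one> = \<ominus> (\<ominus> \<one>)" by simp
    also have "\<dots> = \<zero>" unfolding eq by simp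
    finally show False using one_not_zero by simp
  qed
  have "size (roots P) = Q" using roots_over_carrier[OF P] degree by (simp add: splitted_def)
  moreover have "roots P = mset_set {x \<in> carrier L. x [^] Q = x}"
  proof (rule multiset_eqI)
    fix r
    have fin: "finite {x \<in> carrier L. x [^] Q = x}"
      using finite_number_of_roots[OF P] by (simp add: root_iff)
    have "count (roots P) r = alg_mult P r" by (simp add: alg_mult_eq_count_roots[OF P])
    also have "\<dots> = (if is_root P r then 1 else 0)"
      using simple[of r] alg_mult_gt_zero_iff_is_root[OF P, of r] by (cases "is_root P r") auto
    finally show "count (roots P) r = count (mset_set {x \<in> carrier L. x [^] Q = x}) r"
      using fin by (simp add: root_iff)
  qed
  ultimately show ?thesis by (simp add: Q_def)
qed

text \<open>In an algebraic closure of the prime field, the fixed points of the \<open>k\<close>-th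
  iterate of Frobenius form a subfield. The element type is the one of that closure.\<close>

lemma finite_field_exists:
  assumes p: "Factorial_Ring.prime (p::nat)" and k: "k > 0"
  obtains R :: "((int list \<times> nat) multiset \<Rightarrow> int) ring"
  where "field R" "card (carrier R) = p ^ k"
    "\<And>x y j. x \<in> carrier R \<Longrightarrow> y \<in> carrier R \<Longrightarrow>
      (x \<oplus>\<^bsub>R\<^esub> y) [^]\<^bsub>R\<^esub> (p ^ j) = x [^]\<^bsub>R\<^esub> (p ^ j) \<oplus>\<^bsub>R\<^esub> y [^]\<^bsub>R\<^esub> (p ^ j)"
proof -
  define Z where "Z = residue_ring (int p)"
  interpret Z: residues_prime p Z
    using p by unfold_locales (simp_all add: Z_def prime_gt_1_int)
  interpret Z: field Z by (rule Z.is_field)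
  obtain L :: "((int list \<times> nat) multiset \<Rightarrow> int) ring"
    where cl: "algebraic_closure L (Z.indexed_const ` carrier Z)" and hom: "Z.indexed_const \<in> ring_hom Z L"
    using Z.exists_closure by blast
  interpret L: algebraic_closure L "Z.indexed_const ` carrier Z" by (rule cl)
  interpret h: ring_hom_ring Z L Z.indexed_const
    by (intro ring_hom_ringI2 Z.ring_axioms L.ring_axioms hom)
  have "[n] \<cdot>\<^bsub>L\<^esub> \<one>\<^bsub>L\<^esub> = Z.indexed_const (int n mod int p)" for n :: nat
  proof (induction n)
    case 0
    then show ?case using h.hom_zero by (simp add: Z.res_zero_eq)
  next
    case (Suc n)
    have "Z.indexed_const (int n mod int p \<oplus>\<^bsub>Z\<^esub> \<one>\<^bsub>Z\<^esub>) = Z.indexed_const (int n mod int p) \<oplus>\<^bsub>L\<^esub> \<one>\<^bsub>L\<^esub>"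
      using h.hom_add[of "int n mod int p" "\<one>\<^bsub>Z\<^esub>"] by simp
    moreover have "int n mod int p \<oplus>\<^bsub>Z\<^esub> \<one>\<^bsub>Z\<^esub> = int (Suc n) mod int p"
      by (simp add: Z.res_add_eq Z.res_one_eq mod_add_right_eq add.commute)
    ultimately show ?case using Suc by simp
  qed
  from this[of p] have char: "[p] \<cdot>\<^bsub>L\<^esub> \<one>\<^bsub>L\<^esub> = \<zero>\<^bsub>L\<^esub>" using h.hom_zero by (simp add: Z.res_zero_eq)
  note frob = L.frobenius_add[OF p char]
  define K where "K = {x \<in> carrier L. x [^]\<^bsub>L\<^esub> (p ^ k) = x}"
  have Q: "p ^ k > 0" using prime_gt_0_nat[OF p] by simp
  have "subring K L"
  proof (rule L.subringI)
    fix x assume x: "x \<in> K"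
    \<comment> \<open>Applying Frobenius to \<open>x + (-x) = 0\<close> treats negatives without
      distinguishing the parity of \<open>p\<close>.\<close>
    have "\<zero>\<^bsub>L\<^esub> = (x \<oplus>\<^bsub>L\<^esub> \<ominus>\<^bsub>L\<^esub> x) [^]\<^bsub>L\<^esub> (p ^ k)"
      using x Q by (simp add: K_def L.r_neg L.nat_pow_zero)
    also have "\<dots> = x \<oplus>\<^bsub>L\<^esub> (\<ominus>\<^bsub>L\<^esub> x) [^]\<^bsub>L\<^esub> (p ^ k)" using x frob by (simp add: K_def)
    finally have "(\<ominus>\<^bsub>L\<^esub> x) [^]\<^bsub>L\<^esub> (p ^ k) = \<ominus>\<^bsub>L\<^esub> x"
      using x by (metis (mono_tags, lifting) K_def L.a_inv_closed L.add.inv_equality L.add.m_comm L.nat_pow_closed mem_Collect_eq)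
    then show "\<ominus>\<^bsub>L\<^esub> x \<in> K" using x by (simp add: K_def)
  qed (auto simp: K_def frob L.nat_pow_distrib)
  then have sub: "subfield K L"
  proof (rule L.subfieldI')
    fix x assume x: "x \<in> K - {\<zero>\<^bsub>L\<^esub>}"
    then have xU: "x \<in> Units L" by (simp add: K_def L.field_Units)
    then have "x [^]\<^bsub>L\<^esub> (p ^ k) \<otimes>\<^bsub>L\<^esub> (inv\<^bsub>L\<^esub> x) [^]\<^bsub>L\<^esub> (p ^ k) = \<one>\<^bsub>L\<^esub>"
      using L.nat_pow_distrib[of x "inv\<^bsub>L\<^esub> x" "p ^ k"] by (simp add: L.Units_closed)
    then have "(inv\<^bsub>L\<^esub> x) [^]\<^bsub>L\<^esub> (p ^ k) = inv\<^bsub>L\<^esub> x"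
      using x xU by (intro L.comm_inv_char[symmetric]) (auto simp: K_def)
    then show "inv\<^bsub>L\<^esub> x \<in> K" using xU by (simp add: K_def)
  qed
  show thesis
  proof (rule that[of "L\<lparr>carrier := K\<rparr>"])
    show "field (L\<lparr>carrier := K\<rparr>)" using L.subfield_iff(2)[OF sub] .
    show "card (carrier (L\<lparr>carrier := K\<rparr>)) = p ^ k"
      using L.card_frobenius_fixed[OF p char k] by (simp add: K_def)
  next
    fix x y :: "(int list \<times> nat) multiset \<Rightarrow> int" and j
    assume "x \<in> carrier (L\<lparr>carrier := K\<rparr>)" "y \<in> carrier (L\<lparr>carrier := K\<rparr>)"
    then show "(x \<oplus>\<^bsub>L\<lparr>carrier := K\<rparr>\<^esub> y) [^]\<^bsub>L\<lparr>carrier := K\<rparr>\<^esub> (p ^ j)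
        = x [^]\<^bsub>L\<lparr>carrier := K\<rparr>\<^esub> (p ^ j) \<oplus>\<^bsub>L\<lparr>carrier := K\<rparr>\<^esub> y [^]\<^bsub>L\<lparr>carrier := K\<rparr>\<^esub> (p ^ j)"
      using frob[of x y j] by (simp add: K_def nat_pow_def)
  qed
qed

section \<open>Octic periods of a negacyclic conference matrix\<close>

lemma sum_periodic_shift:
  fixes h :: "nat \<Rightarrow> 'a :: ab_group_add"
  assumes "\<And>k. h (k + n) = h k"
  shows "(\<Sum>j<n. h (j + s)) = (\<Sum>j<n. h j)"
proof (induction s)
  case (Suc s)
  have "(\<Sum>j<n. h (Suc j + s)) + h s = (\<Sum>j<Suc n. h (j + s))"
    by (subst sum.lessThan_Suc_shift) (simp add: add.commute)
  also have "\<dots> = (\<Sum>j<n. h (j + s)) + h s"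
    using assms[of s] by (simp add: add.commute)
  finally show ?case using Suc by simp
qed simp

lemma periodic_mod:
  fixes h :: "nat \<Rightarrow> 'a"
  assumes "\<And>k. h (k + n) = h k"
  shows "h (k mod n) = h k"
proof -
  have "h (m + n * t) = h m" for m t
  proof (induction t)
    case (Suc t)
    then show ?case using assms[of "m + n * t"] by (simp add: algebra_simps)
  qed simp
  from this[of "k mod n" "k div n"] show ?thesis by simp
qed

lemma sum_periodic_scale:
  fixes h :: "nat \<Rightarrow> 'a :: ab_group_add"
  assumes per: "\<And>k. h (k + n) = h k" and cop: "coprime a n" and n: "n > 0"
  shows "(\<Sum>j<n. h (a * j)) = (\<Sum>j<n. h j)"
proof -
  have inj: "inj_on (\<lambda>j. a * j mod n) {..<n}"
  proof (rule inj_onI)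
    fix x y assume xy: "x \<in> {..<n}" "y \<in> {..<n}" "a * x mod n = a * y mod n"
    then have "[a * x = a * y] (mod n)" by (simp add: cong_def)
    then have "[x = y] (mod n)" using cop by (simp add: cong_mult_lcancel_nat)
    then show "x = y" using xy by (simp add: cong_def)
  qed
  have "(\<lambda>j. a * j mod n) ` {..<n} \<subseteq> {..<n}" using n by auto
  then have "bij_betw (\<lambda>j. a * j mod n) {..<n} {..<n}"
    using inj by (simp add: bij_betw_def endo_inj_surj)
  then have "(\<Sum>j<n. h (a * j mod n)) = (\<Sum>j<n. h j)"
    by (rule sum.reindex_bij_betw)
  then show ?thesis using periodic_mod[of h n, OF per] by simp
qed

lemma sum_lessThan_mult:
  fixes h :: "nat \<Rightarrow> 'a :: comm_monoid_add"
  shows "(\<Sum>j<n * m. h j) = (\<Sum>t<m. \<Sum>r<n. h (r + n * t))"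
proof (induction m)
  case (Suc m)
  have "(\<Sum>j<a + b. h j) = (\<Sum>j<a. h j) + (\<Sum>r<b. h (r + a))" for a b
    by (induction b) (simp_all add: ac_simps)
  from this[of "n * m" n] show ?case using Suc by (simp add: add.commute)
qed simp

text \<open>Difference of the indicators of the octic classes 0 and 4. It changes sign under a shift
  by 4, hence by \<open>q + 1\<close>, just like \<open>c\<close> below.\<close>

definition octic_sign :: "nat \<Rightarrow> real" where
  "octic_sign l = (if 8 dvd l then 1 else if 4 dvd l then -1 else 0)"

lemma octic_sign_add4: "octic_sign (l + 4) = - octic_sign l"
  unfolding octic_sign_def by (auto; presburger)

lemma octic_sign_mod8: "octic_sign (l mod 8) = octic_sign l"
proof (rule periodic_mod)
  show "octic_sign (k + 8) = octic_sign k" for k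
    using octic_sign_add4[of k] octic_sign_add4[of "k + 4"] by (simp add: add.assoc)
qed

lemma octic_sign_odd_mult:
  assumes "odd a" shows "octic_sign (a * l) = octic_sign l"
proof -
  have "coprime (2 ^ k) a" for k :: nat using assms by simp
  from this[of 3] this[of 2] have "coprime 8 a" "coprime 4 a" by simp_all
  then show ?thesis unfolding octic_sign_def by (simp add: coprime_dvd_mult_right_iff)
qed

text \<open>Abstracts the values \<open>\<eta> (Tr (\<omega>^k))\<close>. The matrix of all
  \<open>c (j + k)\<close> has orthogonal rows of squared norm \<open>q\<close>, as a conference
  matrix of order \<open>q + 1\<close> does.\<close>

locale octic_conference =
  fixes q :: nat and c :: "nat \<Rightarrow> real"
  assumes q_mod8: "q mod 8 = 3"
    and c_antiperiodic: "c (k + (q + 1)) = - c k"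
    and c_frobenius: "c (q * k) = c k"
    and c_orthogonal: "\<not> [k = l] (mod (q + 1)) \<Longrightarrow> (\<Sum>j<q+1. c (j + k) * c (j + l)) = 0"
    and c_norm: "(\<Sum>j<q+1. c (j + k) * c (j + k)) = real q"
begin

text \<open>Octic period of \<open>c\<close>. Both factors change sign when \<open>l\<close> grows
  by \<open>q + 1\<close>, so the summand is periodic and its range can be shifted or rescaled by a
  unit.\<close>

definition g :: "nat \<Rightarrow> real" where
  "g m = (\<Sum>l<q+1. octic_sign l * c (l + m))"

lemma octic_sign_antiperiodic: "octic_sign (l + (q + 1)) = - octic_sign l"
proof -
  have "octic_sign (l + 4 + 8 * (q div 8)) = octic_sign (l + 4)"
    using octic_sign_mod8[of "l + 4 + 8 * (q div 8)"] octic_sign_mod8[of "l + 4"] by simp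
  moreover have "l + (q + 1) = l + 4 + 8 * (q div 8)"
    using q_mod8 div_mult_mod_eq[of q 8] by linarith
  ultimately have "octic_sign (l + (q + 1)) = octic_sign (l + 4)" by (simp only:)
  then show ?thesis by (simp only: octic_sign_add4)
qed

lemma c_shift: "c (k + (q + 1) * t) = (-1) ^ t * c k"
proof (induction t)
  case (Suc t)
  then show ?case using c_antiperiodic[of "k + (q+1) * t"] by (simp add: algebra_simps)
qed simp

lemma octic_sign_shift: "octic_sign (k + (q + 1) * t) = (-1) ^ t * octic_sign k"
proof (induction t)
  case (Suc t)
  then show ?case using octic_sign_antiperiodic[of "k + (q+1) * t"] by (simp add: algebra_simps)
qed simp

lemma g_add4: "g (m + 4) = - g m"
proof -
  have per: "octic_sign (k + (q + 1)) * c (k + (q + 1) + m) = octic_sign k * c (k + m)" for k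
    using octic_sign_antiperiodic[of k] c_antiperiodic[of "k + m"] by (simp add: algebra_simps)
  have "g (m + 4) = - (\<Sum>l<q+1. octic_sign (l + 4) * c ((l + 4) + m))"
    unfolding g_def octic_sign_add4 by (simp add: sum_negf algebra_simps)
  also have "\<dots> = - g m"
    unfolding g_def
    using sum_periodic_shift[of "\<lambda>l. octic_sign l * c (l + m)" "q+1" 4, OF per] by simp
  finally show ?thesis .
qed

lemma g_antiperiodic: "g (m + (q + 1)) = - g m"
  unfolding g_def using c_antiperiodic
  by (simp add: sum_negf flip: add.assoc)

lemma g_mod8: "g (m mod 8) = g m"
proof (rule periodic_mod)
  show "g (k + 8) = g k" for k using g_add4[of k] g_add4[of "k+4"] by (simp add: add.assoc)
qed

lemma g_cong: "m mod 8 = n mod 8 \<Longrightarrow> g m = g n"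
  by (subst (1 2) g_mod8[symmetric]) simp

text \<open>Replacing \<open>l\<close> by \<open>q * l\<close> permutes the residues modulo
  \<open>q + 1\<close>; \<open>octic_sign\<close> ignores the odd factor and \<open>c\<close> is
  Frobenius invariant.\<close>

lemma g_frobenius: "g (q * m) = g m"
proof -
  have per: "octic_sign (k + (q + 1)) * c (k + (q + 1) + q * m) = octic_sign k * c (k + q * m)" for k
    using octic_sign_antiperiodic[of k] c_antiperiodic[of "k + q * m"] by (simp add: algebra_simps)
  have odd: "odd q" using q_mod8 by presburger
  have "g (q * m) = (\<Sum>l<q+1. octic_sign (q * l) * c (q * l + q * m))"
    unfolding g_def
    using sum_periodic_scale[of "\<lambda>l. octic_sign l * c (l + q * m)" "q+1" q, OF per] by simp
  also have "\<dots> = g m"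
    unfolding g_def octic_sign_odd_mult[OF odd] c_frobenius distrib_left[symmetric] ..
  finally show ?thesis .
qed

text \<open>On indices modulo 8, multiplication by \<open>q\<close> is multiplication by 3.\<close>

lemma g_triple: "g (3 * m) = g m"
proof -
  have "(3 * m) mod 8 = (q * m) mod 8" using mod_mult_left_eq[of q 8 m] q_mod8 by simp
  then have "g (3 * m) = g (q * m)" by (rule g_cong)
  then show ?thesis by (simp only: g_frobenius)
qed

text \<open>Tripling 2 gives 6, four steps away from 2, so the value is its own negative.\<close>

lemma g_2: "g 2 = 0"
  using g_triple[of 2] g_add4[of 2] by simp

lemma g_3: "g 3 = g 1"
  using g_triple[of 1] by simp

text \<open>Orthogonality of the translates of \<open>c\<close> inverts the sum defining
  \<open>g\<close>. The term \<open>7 * r\<close> stands for \<open>-r\<close> modulo 8.\<close>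

lemma g_inversion: "(\<Sum>j<q+1. g (j + r) * c (j + k)) = real q * octic_sign (k + 7 * r)"
proof -
  have base: "(\<Sum>j<q+1. g j * c (j + k)) = real q * octic_sign k" for k
  proof -
    \<comment> \<open>Only the index \<open>l0\<close> pairs nontrivially with \<open>k\<close>. The
      sign \<open>(-1) ^ t\<close> from reducing \<open>k\<close> occurs both in \<open>c\<close>
      and in \<open>octic_sign\<close>.\<close>
    define l0 where "l0 = k mod (q + 1)"
    define t where "t = k div (q + 1)"
    have k: "k = l0 + (q + 1) * t" unfolding l0_def t_def by (rule mod_mult_div_eq[symmetric])
    have l0: "l0 < q + 1" unfolding l0_def by (rule mod_less_divisor) simp
    have "(\<Sum>j<q+1. g j * c (j + k)) = (\<Sum>l<q+1. octic_sign l * (\<Sum>j<q+1. c (j + l) * c (j + k)))"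
      unfolding g_def sum_distrib_left sum_distrib_right
      by (subst sum.swap) (simp add: algebra_simps)
    also have "\<dots> = (\<Sum>l<q+1. if l = l0 then octic_sign l0 * (\<Sum>j<q+1. c (j + l0) * c (j + k)) else 0)"
    proof (rule sum.cong)
      fix l assume "l \<in> {..<q+1}"
      then have "[l = k] (mod (q + 1)) \<longleftrightarrow> l = l0" by (auto simp: cong_def l0_def)
      then show "octic_sign l * (\<Sum>j<q+1. c (j + l) * c (j + k))
          = (if l = l0 then octic_sign l0 * (\<Sum>j<q+1. c (j + l0) * c (j + k)) else 0)"
        using c_orthogonal[of l k] by auto
    qed simp
    also have "\<dots> = octic_sign l0 * (\<Sum>j<q+1. c (j + l0) * c (j + k))"
      using l0 by (simp only: sum.delta finite_lessThan lessThan_iff if_True)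
    also have "(\<Sum>j<q+1. c (j + l0) * c (j + k)) = (-1) ^ t * real q"
    proof -
      have "c (j + k) = (-1) ^ t * c (j + l0)" for j
        using c_shift[of "j + l0" t] k by (simp add: add.assoc)
      then have "(\<Sum>j<q+1. c (j + l0) * c (j + k)) = (-1) ^ t * (\<Sum>j<q+1. c (j + l0) * c (j + l0))"
        by (simp add: sum_distrib_left algebra_simps)
      then show ?thesis using c_norm[of l0] by simp
    qed
    finally show ?thesis using octic_sign_shift[of l0 t] k by simp
  qed
  have per: "g (j + (q + 1) + r) * c (j + (q + 1) + k) = g (j + r) * c (j + k)" for j
    using g_antiperiodic[of "j + r"] c_antiperiodic[of "j + k"] by (simp add: algebra_simps)
  have 8: "g (j + 7 * r + r) = g j" for j
  proof -
    have "j + 7 * r + r = j + 8 * r" by simp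
    then have "(j + 7 * r + r) mod 8 = j mod 8" by (simp only: mod_mult_self2)
    then show ?thesis by (rule g_cong)
  qed
  have "(\<Sum>j<q+1. g (j + r) * c (j + k)) = (\<Sum>j<q+1. g (j + 7 * r + r) * c (j + 7 * r + k))"
    using sum_periodic_shift[of "\<lambda>j. g (j + r) * c (j + k)" "q + 1" "7 * r", OF per] by simp
  also have "\<dots> = (\<Sum>j<q+1. g j * c (j + (k + 7 * r)))"
    unfolding 8 by (simp add: algebra_simps)
  finally show ?thesis using base by simp
qed

text \<open>A Parseval identity obtained from \<open>g_inversion\<close>. In each block of four
  indices the squares of \<open>g\<close> add up to the left side, while exactly one octic sign is
  nonzero.\<close>

lemma g_squares: "(g 0)\<^sup>2 + 2 * (g 1)\<^sup>2 = real q"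
proof -
  define m where "m = 2 * (q div 8) + 1"
  have m: "q + 1 = 4 * m"
  proof -
    have "q = 8 * (q div 8) + 3" using q_mod8 div_mult_mod_eq[of q 8] by linarith
    moreover have "8 * x + 3 + 1 = 4 * (2 * x + 1)" for x :: nat by simp
    ultimately show ?thesis unfolding m_def by metis
  qed
  have m_pos: "m > 0" by (simp add: m_def)
  have periodic: "h (r + 4 * t) = h r" if "\<And>r. h (r + 4) = h r" for h :: "nat \<Rightarrow> real" and r t
    using periodic_mod[of h 4 "r + 4 * t", OF that] periodic_mod[of h 4 r, OF that] by simp
  have sq: "(g (r + 4 * t))\<^sup>2 = (g r)\<^sup>2" "(octic_sign (r + 4 * t))\<^sup>2 = (octic_sign r)\<^sup>2" for r t
    using periodic[of "\<lambda>r. (g r)\<^sup>2"] periodic[of "\<lambda>r. (octic_sign r)\<^sup>2"]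
    by (simp_all add: g_add4 octic_sign_add4)
  have "real m * ((g 0)\<^sup>2 + 2 * (g 1)\<^sup>2) = (\<Sum>j<q+1. (g j)\<^sup>2)"
    unfolding m sum_lessThan_mult sq
    using g_2 g_3 by (simp add: lessThan_nat_numeral algebra_simps)
  also have "\<dots> = (\<Sum>j<q+1. \<Sum>l<q+1. octic_sign l * (g j * c (j + l)))"
    by (subst (1) power2_eq_square, subst (2) g_def)
       (simp add: sum_distrib_left algebra_simps)
  also have "\<dots> = (\<Sum>l<q+1. octic_sign l * (\<Sum>j<q+1. g j * c (j + l)))"
    by (subst sum.swap) (simp only: sum_distrib_left)
  also have "\<dots> = (\<Sum>l<q+1. real q * (octic_sign l)\<^sup>2)"
    using g_inversion[of 0] by (simp add: power2_eq_square mult_ac del: sum.lessThan_Suc)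
  also have "\<dots> = real m * real q"
    unfolding m sum_lessThan_mult sq
    by (simp add: lessThan_nat_numeral octic_sign_def)
  finally show ?thesis using m_pos by simp
qed

end

section \<open>Ridge functions on a quadratic extension\<close>

locale quadratic_extension = field R for R (structure) +
  fixes q m :: nat and \<omega> :: 'a
  assumes q_eq: "q = 8 * m + 3"
    and card_R: "card (carrier R) = q\<^sup>2"
    and frobenius: "x \<in> carrier R \<Longrightarrow> y \<in> carrier R \<Longrightarrow> (x \<oplus> y) [^] q = x [^] q \<oplus> y [^] q"
    and \<omega>_closed: "\<omega> \<in> carrier R - {\<zero>}"
    and \<omega>_generates: "carrier R - {\<zero>} = {\<omega> [^] i | i :: nat. True}"
begin

section \<open>Powers of the generator\<close>

definition e :: "nat \<Rightarrow> 'a" where "e k = \<omega> [^] k"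
definition N :: nat where "N = (q + 1) * (q - 1)"

lemma q_gt: "q > 1" using q_eq by linarith

lemma N_eq: "N = q\<^sup>2 - 1"
  using q_gt by (simp add: N_def power2_eq_square algebra_simps)

lemma N_pos: "N > 0" using q_gt by (simp add: N_def)

lemma half_q: "q - 1 = 2 * (4 * m + 1)" using q_eq by simp

lemma q_plus: "q + 1 = 2 * (4 * m + 2)" using q_eq by simp

lemma finite_R: "finite (carrier R)"
  using card_R q_gt by (intro card_ge_0_finite) simp

lemma e_closed [simp]: "e k \<in> carrier R" "e k \<noteq> \<zero>"
  using \<omega>_generates by (auto simp: e_def)

lemma e_add: "e (i + j) = e i \<otimes> e j"
  using \<omega>_closed by (simp add: e_def nat_pow_mult)

lemma e_pow: "(e i) [^] (n::nat) = e (i * n)"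
  using \<omega>_closed by (simp add: e_def nat_pow_pow)

lemma e_zero [simp]: "e 0 = \<one>" by (simp add: e_def)

lemma card_units: "card (carrier R - {\<zero>}) = N"
  using card_R finite_R N_eq by (simp add: card_Diff_singleton)

lemma e_N: "e N = \<one>"
proof -
  interpret M: group "Multiplicative_Group.mult_of R" by (rule field_mult_group)
  have "\<omega> [^]\<^bsub>Multiplicative_Group.mult_of R\<^esub> order (Multiplicative_Group.mult_of R) = \<one>\<^bsub>Multiplicative_Group.mult_of R\<^esub>"
    using \<omega>_closed by (intro M.pow_order_eq_1) simp
  then show ?thesis using card_units by (simp add: e_def Multiplicative_Group.nat_pow_mult_of order_def)
qed

lemma e_mod: "e (k mod N) = e k"
  by (rule periodic_mod) (use e_N in \<open>simp add: e_add\<close>)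

lemma e_bij: "bij_betw e {..<N} (carrier R - {\<zero>})"
proof -
  have "e ` {..<N} = carrier R - {\<zero>}"
  proof
    show "carrier R - {\<zero>} \<subseteq> e ` {..<N}"
    proof
      fix x assume "x \<in> carrier R - {\<zero>}"
      then obtain i :: nat where "x = e i" using \<omega>_generates by (auto simp: e_def)
      then have "x = e (i mod N)" by (simp only: e_mod)
      moreover have "i mod N < N" using N_pos by (rule mod_less_divisor)
      ultimately show "x \<in> e ` {..<N}" by blast
    qed
  qed auto
  moreover from this have "inj_on e {..<N}"
    by (intro eq_card_imp_inj_on) (simp_all only: card_units card_lessThan finite_lessThan)
  ultimately show ?thesis by (simp add: bij_betw_def)
qed

lemma e_eq_iff: "e i = e j \<longleftrightarrow> [i = j] (mod N)"
proof
  assume "e i = e j"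
  then have "e (i mod N) = e (j mod N)" by (simp only: e_mod)
  then have "i mod N = j mod N"
    using e_bij N_pos by (auto simp only: bij_betw_def dest!: inj_onD intro!: mod_less_divisor simp: lessThan_iff)
  then show "[i = j] (mod N)" by (simp only: cong_def)
next
  assume "[i = j] (mod N)"
  then have "i mod N = j mod N" by (simp only: cong_def)
  then show "e i = e j" by (metis e_mod)
qed

lemma nonzero_cases:
  assumes "x \<in> carrier R" "x \<noteq> \<zero>" obtains k where "x = e k"
  using assms \<omega>_generates by (auto simp: e_def)

definition z :: "nat \<Rightarrow> 'a" where "z t = e ((q + 1) * t)"

lemma z_closed [simp]: "z t \<in> carrier R" "z t \<noteq> \<zero>" unfolding z_def by (rule e_closed)+

lemma z_add: "z (s + t) = z s \<otimes> z t" by (simp only: z_def distrib_left e_add)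

lemma z_eq_iff: "z s = z t \<longleftrightarrow> [s = t] (mod (q - 1))"
proof -
  have "z s = z t \<longleftrightarrow> (q + 1) * (s mod (q - 1)) = (q + 1) * (t mod (q - 1))"
    unfolding z_def e_eq_iff cong_def N_def by (simp only: mod_mult_mult1)
  then show ?thesis by (simp only: cong_def mult_cancel1) simp
qed

text \<open>The exponent \<open>(q + 1) * (4 * m + 1)\<close> is half of \<open>N\<close>, so this
  power squares to 1 without being 1. As \<open>4 * m + 1\<close> is odd, -1 will be a nonsquare of
  \<open>F\<close>.\<close>

lemma minus_one_eq: "\<ominus> \<one> = z (4 * m + 1)"
proof -
  define h where "h = (q + 1) * (4 * m + 1)"
  have h2: "h + h = N" unfolding N_def half_q h_def by (simp only: mult_2 distrib_left)
  have "h < N" "h > 0" using h2 N_pos by linarith+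
  then have "\<not> [h = 0] (mod N)" by (simp add: cong_def)
  then have ne: "e h \<noteq> \<one>" using e_eq_iff[of h 0] by simp
  have sq: "e h \<otimes> e h = \<one>" using e_add[of h h] unfolding h2 e_N by simp
  have "(y \<ominus> \<one>) \<otimes> (y \<oplus> \<one>) = y \<otimes> y \<ominus> \<one>" if "y \<in> carrier R" for y
    using that by (simp add: a_minus_def l_distr r_distr l_minus a_assoc)
  then have "(e h \<ominus> \<one>) \<otimes> (e h \<oplus> \<one>) = \<zero>" using sq by (simp add: a_minus_def r_neg)
  then have "e h \<ominus> \<one> = \<zero> \<or> e h \<oplus> \<one> = \<zero>" by (rule integral) simp_all
  then have "e h \<oplus> \<one> = \<zero>" using ne by simp
  then show ?thesis using minus_equality[of "e h" \<one>] by (simp add: h_def z_def)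
qed

section \<open>The subfield of order \<open>q\<close> and the trace\<close>

definition F :: "'a set" where "F = {x \<in> carrier R. x [^] q = x}"
definition Tr :: "'a \<Rightarrow> 'a" where "Tr x = x \<oplus> x [^] q"

lemma F_I: "x \<in> carrier R \<Longrightarrow> x [^] q = x \<Longrightarrow> x \<in> F" by (simp add: F_def)

lemma F_pow: "x \<in> F \<Longrightarrow> x [^] q = x" by (simp add: F_def)

lemma F_closed [simp]: "x \<in> F \<Longrightarrow> x \<in> carrier R" by (simp add: F_def)

lemma zero_in_F [simp]: "\<zero> \<in> F" using q_gt by (intro F_I) (simp_all add: nat_pow_zero)

lemma one_in_F [simp]: "\<one> \<in> F" by (intro F_I) simp_all

lemma F_add [simp]: "x \<in> F \<Longrightarrow> y \<in> F \<Longrightarrow> x \<oplus> y \<in> F" by (intro F_I) (simp_all add: frobenius F_pow)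

lemma F_mult [simp]: "x \<in> F \<Longrightarrow> y \<in> F \<Longrightarrow> x \<otimes> y \<in> F" by (intro F_I) (simp_all add: nat_pow_distrib F_pow)

lemma e_in_F_iff: "e k \<in> F \<longleftrightarrow> (q + 1) dvd k"
proof -
  have "e k \<in> F \<longleftrightarrow> e k [^] q = e k" using F_I[of "e k"] F_pow[of "e k"] by auto
  also have "\<dots> \<longleftrightarrow> [k * q = k] (mod N)" by (simp add: e_pow e_eq_iff)
  also have "\<dots> \<longleftrightarrow> [k + k * (q - 1) = k] (mod N)"
    using q_gt by (simp add: algebra_simps)
  also have "\<dots> \<longleftrightarrow> (q + 1) * (q - 1) dvd k * (q - 1)"
    by (simp add: cong_add_lcancel_0_nat cong_0_iff N_def)
  also have "\<dots> \<longleftrightarrow> (q + 1) dvd k" using q_gt by (simp only: dvd_times_right_cancel_iff)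
  finally show ?thesis .
qed

lemma minus_eq: "x \<in> carrier R \<Longrightarrow> \<ominus> x = z (4 * m + 1) \<otimes> x"
  unfolding minus_one_eq[symmetric] using l_minus[of \<one> x] by simp

lemma z_in_F [simp]: "z t \<in> F" by (simp only: z_def e_in_F_iff dvd_triv_left)

lemma F_minus [simp]: "x \<in> F \<Longrightarrow> \<ominus> x \<in> F" by (simp add: minus_eq)

lemma Tr_in_F [simp]: assumes "x \<in> carrier R" shows "Tr x \<in> F"
proof -
  have "x [^] (q * q) = x"
  proof (cases "x = \<zero>")
    case False
    then obtain k where k: "x = e k" using assms nonzero_cases[of x] by blast
    have "k * (q * q) = k + N * k" using q_gt by (simp add: N_eq power2_eq_square algebra_simps)
    then show ?thesis unfolding k by (simp add: e_pow e_eq_iff cong_def)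
  qed (use q_gt in \<open>simp add: nat_pow_zero\<close>)
  then show ?thesis using assms by (intro F_I) (simp_all add: Tr_def frobenius nat_pow_pow a_comm)
qed

lemma Tr_add: "x \<in> carrier R \<Longrightarrow> y \<in> carrier R \<Longrightarrow> Tr (x \<oplus> y) = Tr x \<oplus> Tr y"
  by (simp add: Tr_def frobenius a_ac)

lemma Tr_zero [simp]: "Tr \<zero> = \<zero>" using q_gt by (simp add: Tr_def nat_pow_zero)

lemma Tr_scale: "c \<in> F \<Longrightarrow> x \<in> carrier R \<Longrightarrow> Tr (c \<otimes> x) = c \<otimes> Tr x"
  by (simp add: Tr_def F_pow nat_pow_distrib r_distr)

text \<open>The trace vanishes when \<open>e (k * (q - 1))\<close> is -1, whose exponent is
  \<open>N / 2 = (4 * m + 2) * (q - 1)\<close>. So the kernel is a single line over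
  \<open>F\<close>.\<close>

lemma Tr_e_eq_zero_iff: "Tr (e k) = \<zero> \<longleftrightarrow> [k = 4 * m + 2] (mod (q + 1))"
proof -
  have "Tr (e k) = \<zero> \<longleftrightarrow> e (k * q) = \<ominus> e k"
    using minus_equality[of "e (k * q)" "e k"] by (auto simp: Tr_def e_pow r_neg a_comm)
  also have "\<dots> \<longleftrightarrow> e (k * q) = e (k + (q + 1) * (4 * m + 1))"
    unfolding minus_eq[OF e_closed(1)] z_def e_add using m_comm[OF e_closed(1) e_closed(1)] by simp
  also have "\<dots> \<longleftrightarrow> [k + k * (q - 1) = k + (q + 1) * (4 * m + 1)] (mod N)"
    unfolding e_eq_iff using q_gt by (simp add: algebra_simps)
  also have "\<dots> \<longleftrightarrow> [k * (q - 1) = (q + 1) * (4 * m + 1)] (mod N)"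
    by (simp only: cong_add_lcancel_nat)
  also have "(q + 1) * (4 * m + 1) = (4 * m + 2) * (q - 1)"
    unfolding half_q q_plus by simp
  also have "[k * (q - 1) = (4 * m + 2) * (q - 1)] (mod N) \<longleftrightarrow> [k = 4 * m + 2] (mod (q + 1))"
    unfolding N_def cong_def using q_gt by (simp only: mod_mult_mult2 mult_cancel2) auto
  finally show ?thesis .
qed

lemma F_cases:
  assumes "x \<in> F" obtains "x = \<zero>" | t where "x = z t"
proof (cases "x = \<zero>")
  case False
  then obtain k where "x = e k" using assms nonzero_cases[of x] by auto
  then show ?thesis using assms that(2) by (auto simp only: e_in_F_iff z_def elim!: dvdE)
qed (use that in auto)

lemma F_bij: "bij_betw (z) {..<q - 1} (F - {\<zero>})"
proof (rule bij_betwI')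
  fix s t assume "s \<in> {..<q - 1}" "t \<in> {..<q - 1}"
  then show "z s = z t \<longleftrightarrow> s = t" by (simp add: z_eq_iff cong_def)
next
  fix x assume x: "x \<in> F - {\<zero>}"
  then obtain t where t: "x = z t" by (auto elim: F_cases)
  then have "x = z (t mod (q - 1))" by (simp add: z_eq_iff cong_def)
  then show "\<exists>t\<in>{..<q - 1}. x = z t" using q_gt by (intro bexI) auto
qed simp

lemma finite_F: "finite F" using finite_subset[OF _ finite_R, of F] F_closed by blast

lemma sum_F:
  fixes G :: "'a \<Rightarrow> real"
  shows "(\<Sum>t\<in>F. G t) = G \<zero> + (\<Sum>t<q - 1. G (z t))"
  using sum.reindex_bij_betw[OF F_bij, of G] finite_F by (simp add: sum.remove[of F \<zero>])

lemma card_F: "card F = q"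
  using bij_betw_same_card[OF F_bij] finite_F q_gt by (simp add: card_Diff_singleton)

text \<open>The quadratic character of \<open>F\<close>; outside \<open>F\<close> the value is the meaningless -1.\<close>

definition \<eta> :: "'a \<Rightarrow> real" where
  "\<eta> x = (if x = \<zero> then 0 else if \<exists>t. x = z (2 * t) then 1 else -1)"

lemma \<eta>_zero [simp]: "\<eta> \<zero> = 0" by (simp add: \<eta>_def)

lemma \<eta>_z: "\<eta> (z t) = (-1) ^ t"
proof (cases "even t")
  case True
  then show ?thesis by (auto simp: \<eta>_def elim!: evenE)
next
  case False
  have "z t \<noteq> z (2 * s)" for s
  proof
    assume "z t = z (2 * s)"
    then have "[t = 2 * s] (mod (q - 1))" by (simp only: z_eq_iff)
    then have "[t = 2 * s] (mod 2)" by (rule cong_dvd_modulus_nat) (simp only: half_q dvd_triv_left)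
    then show False using False by (simp add: cong_def odd_iff_mod_2_eq_one)
  qed
  then show ?thesis using False by (simp add: \<eta>_def)
qed

lemma \<eta>_mult: assumes "x \<in> F" "y \<in> F" shows "\<eta> (x \<otimes> y) = \<eta> x * \<eta> y"
  using assms(1)
proof (cases rule: F_cases)
  case x: (2 s)
  show ?thesis using assms(2)
  proof (cases rule: F_cases)
    case y: (2 t)
    show ?thesis unfolding x y by (simp only: z_add[symmetric] \<eta>_z power_add)
  qed (use assms in simp)
qed (use assms in simp)

lemma \<eta>_minus: "x \<in> F \<Longrightarrow> \<eta> (\<ominus> x) = - \<eta> x"
  by (simp add: minus_eq \<eta>_mult \<eta>_z del: One_nat_def)

lemma \<eta>_square: "x \<in> F \<Longrightarrow> \<eta> x * \<eta> x = (if x = \<zero> then 0 else 1)"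
  by (simp add: \<eta>_def)

lemma sum_\<eta>: "(\<Sum>t\<in>F. \<eta> t) = 0"
proof -
  have "(\<Sum>t<2 * n. (-1) ^ t) = (0::real)" for n by (induction n) simp_all
  then show ?thesis unfolding sum_F \<eta>_z half_q by (simp only: \<eta>_zero add_0_left)
qed

lemma sum_F_translate:
  fixes G :: "'a \<Rightarrow> real"
  assumes s: "s \<in> F" shows "(\<Sum>t\<in>F. G (t \<oplus> s)) = (\<Sum>t\<in>F. G t)"
  by (rule sum.reindex_bij_witness[of _ "\<lambda>t. t \<oplus> \<ominus> s" "\<lambda>t. t \<oplus> s"])
     (use s in \<open>auto simp: a_assoc l_neg r_neg\<close>)

lemma sum_\<eta>_square: "(\<Sum>t\<in>F. \<eta> t * \<eta> t) = real q - 1"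
  unfolding sum_F \<eta>_z using q_gt by (simp add: of_nat_diff flip: power_mult_distrib)

text \<open>The sum does not depend on \<open>s \<noteq> 0\<close>, and the sums for all \<open>s \<in> F\<close> add up to \<open>(\<Sum>t\<in>F. \<eta> t)\<^sup>2 = 0\<close>.\<close>

lemma \<eta>_autocorrelation:
  assumes s: "s \<in> F" "s \<noteq> \<zero>" shows "(\<Sum>t\<in>F. \<eta> t * \<eta> (t \<oplus> s)) = -1"
proof -
  define A where "A s = (\<Sum>t\<in>F. \<eta> t * \<eta> (t \<oplus> s))" for s
  have A_one: "A s = A \<one>" if s: "s \<in> F" "s \<noteq> \<zero>" for s
  proof -
    have inv_s: "inv s \<in> carrier R" "s \<otimes> inv s = \<one>" using s by (simp_all add: field_Units)
    have "inv s \<in> F"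
    proof -
      have "s \<otimes> inv s [^] q = (s \<otimes> inv s) [^] q" using s(1) inv_s(1) by (simp add: F_pow nat_pow_distrib)
      then have "inv s = inv s [^] q" using s inv_s by (intro comm_inv_char) auto
      then show ?thesis using inv_s by (intro F_I) auto
    qed
    \<comment> \<open>Rescaling the variable by \<open>s\<close> pulls out the factor
      \<open>\<eta> s * \<eta> s = 1\<close>.\<close>
    then have "A s = (\<Sum>t\<in>F. \<eta> (s \<otimes> t) * \<eta> (s \<otimes> t \<oplus> s))"
      unfolding A_def
      by (intro sum.reindex_bij_witness[of _ "\<lambda>t. s \<otimes> t" "\<lambda>t. inv s \<otimes> t"])
         (use s inv_s in \<open>auto simp: m_assoc[symmetric] m_comm[of "inv s" s]\<close>)
    also have "\<dots> = (\<Sum>t\<in>F. \<eta> t * \<eta> (t \<oplus> \<one>))"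
    proof (rule sum.cong)
      fix t assume t: "t \<in> F"
      have "s \<otimes> t \<oplus> s = s \<otimes> (t \<oplus> \<one>)" using s t by (simp add: r_distr)
      then have "\<eta> (s \<otimes> t) * \<eta> (s \<otimes> t \<oplus> s) = (\<eta> s * \<eta> s) * (\<eta> t * \<eta> (t \<oplus> \<one>))"
        using s t by (simp add: \<eta>_mult)
      then show "\<eta> (s \<otimes> t) * \<eta> (s \<otimes> t \<oplus> s) = \<eta> t * \<eta> (t \<oplus> \<one>)"
        using s by (simp add: \<eta>_square)
    qed simp
    finally show ?thesis by (simp add: A_def)
  qed
  have "(\<Sum>s\<in>F. A s) = (\<Sum>t\<in>F. \<eta> t * (\<Sum>s\<in>F. \<eta> (s \<oplus> t)))"
    unfolding A_def by (subst sum.swap) (simp add: sum_distrib_left a_comm cong: sum.cong)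
  also have "\<dots> = 0" by (simp add: sum_F_translate sum_\<eta>)
  finally have "A \<zero> + (\<Sum>s\<in>F - {\<zero>}. A s) = 0" using finite_F by (simp add: sum.remove[of F \<zero>])
  moreover have "A \<zero> = real q - 1" unfolding A_def using sum_\<eta>_square by (simp cong: sum.cong)
  moreover have "(\<Sum>s\<in>F - {\<zero>}. A s) = (\<Sum>s\<in>F - {\<zero>}. A \<one>)" by (intro sum.cong refl A_one) auto
  ultimately have "(real q - 1) * (1 + A \<one>) = 0"
    using finite_F card_F q_gt by (simp add: card_Diff_singleton algebra_simps)
  then have "A \<one> = -1" using q_gt by simp
  then show ?thesis using A_one[OF s] by (simp add: A_def)
qed

section \<open>Independence of traces in different directions\<close>

lemma trace_pair_bij:
  assumes ij: "\<not> [i = j] (mod (q + 1))"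
  shows "bij_betw (\<lambda>x. (Tr (e i \<otimes> x), Tr (e j \<otimes> x))) (carrier R) (F \<times> F)"
proof -
  let ?T = "\<lambda>x. (Tr (e i \<otimes> x), Tr (e j \<otimes> x))"
  \<comment> \<open>A nonzero difference \<open>e k\<close> with both traces zero would put
    \<open>i + k\<close> and \<open>j + k\<close> into the same class modulo \<open>q + 1\<close>.
    Surjectivity follows by counting.\<close>
  have "inj_on ?T (carrier R)"
  proof (rule inj_onI, rule ccontr)
    fix x y assume xy: "x \<in> carrier R" "y \<in> carrier R" and eq: "?T x = ?T y" and ne: "x \<noteq> y"
    define d where "d = x \<ominus> y"
    have d: "d \<in> carrier R" "d \<noteq> \<zero>" "x = y \<oplus> d"
      using xy ne by (simp_all add: d_def a_minus_def a_lcomm r_neg) (simp flip: a_minus_def)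
    have zero: "Tr (e l \<otimes> d) = \<zero>" if "Tr (e l \<otimes> x) = Tr (e l \<otimes> y)" for l
    proof -
      have "Tr (e l \<otimes> y) \<oplus> Tr (e l \<otimes> d) = Tr (e l \<otimes> y)"
        using that d xy by (simp add: r_distr Tr_add)
      then show ?thesis using xy d by (simp add: add.r_cancel_one')
    qed
    obtain k where k: "d = e k" using d nonzero_cases by blast
    have "[i + k = 4 * m + 2] (mod (q + 1))" "[j + k = 4 * m + 2] (mod (q + 1))"
      using zero[of i] zero[of j] eq unfolding k e_add[symmetric] Tr_e_eq_zero_iff by blast+
    then have "[i + k = j + k] (mod (q + 1))" using cong_sym cong_trans by blast
    then show False using ij by (simp only: cong_add_rcancel_nat)
  qed
  moreover have "?T ` carrier R = F \<times> F"
  proof (rule card_seteq)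
    show "finite (F \<times> F)" using finite_F by simp
    show "?T ` carrier R \<subseteq> F \<times> F" by auto
    show "card (F \<times> F) \<le> card (?T ` carrier R)"
      using card_image[OF calculation] card_R card_F by (simp add: card_cartesian_product power2_eq_square)
  qed
  ultimately show ?thesis by (simp add: bij_betw_def)
qed

lemma sum_trace_pair:
  fixes G H :: "'a \<Rightarrow> real"
  assumes ij: "\<not> [i = j] (mod (q + 1))"
  shows "(\<Sum>x\<in>carrier R. G (Tr (e i \<otimes> x)) * H (Tr (e j \<otimes> x))) = (\<Sum>t\<in>F. G t) * (\<Sum>t\<in>F. H t)"
proof -
  have "(\<Sum>x\<in>carrier R. (\<lambda>(s, t). G s * H t) (Tr (e i \<otimes> x), Tr (e j \<otimes> x))) = (\<Sum>(s, t)\<in>F \<times> F. G s * H t)"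
    by (rule sum.reindex_bij_betw[OF trace_pair_bij[OF ij]])
  then show ?thesis by (simp add: sum_product sum.cartesian_product)
qed

lemma sum_trace:
  fixes G :: "'a \<Rightarrow> real"
  shows "(\<Sum>x\<in>carrier R. G (Tr (e i \<otimes> x))) = real q * (\<Sum>t\<in>F. G t)"
proof -
  \<comment> \<open>The direction \<open>i + 1\<close> is a partner carrying the constant function
    1, whose sum over \<open>F\<close> is \<open>q\<close>.\<close>
  have "\<not> [i = i + 1] (mod (q + 1))"
  proof
    assume "[i = i + 1] (mod (q + 1))"
    then have "[i + 0 = i + 1] (mod (q + 1))" by simp
    then have "[0 = 1] (mod (q + 1))" by (simp only: cong_add_lcancel_nat)
    then show False using q_gt by (simp add: cong_def)
  qed
  from sum_trace_pair[OF this, of G "\<lambda>_. 1"] show ?thesis using card_F by (simp add: mult.commute)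
qed

definition c :: "nat \<Rightarrow> real" where "c k = \<eta> (Tr (e k))"

text \<open>Zero contributes nothing, and the powers \<open>e j\<close> run through
  \<open>q - 1\<close> equal blocks. Antiperiodicity is a premise because it is derived only within
  the sublocale proof.\<close>

lemma sum_products_c:
  "(\<Sum>x\<in>carrier R. \<eta> (Tr (e k \<otimes> x)) * \<eta> (Tr (e l \<otimes> x)))
    = (real q - 1) * (\<Sum>j<q+1. c (j + k) * c (j + l))"
  if anti: "\<And>k. c (k + (q + 1)) = - c k"
proof -
  let ?P = "\<lambda>j. c (j + k) * c (j + l)"
  have per: "?P (j + (q + 1)) = ?P j" for j
    using anti[of "j + k"] anti[of "j + l"] by (simp add: algebra_simps)
  have shift: "?P (r + (q + 1) * t) = ?P r" for r t
    using periodic_mod[of ?P "q + 1" "r + (q + 1) * t", OF per] periodic_mod[of ?P "q + 1" r, OF per]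
    unfolding mod_mult_self2 by argo
  have "(\<Sum>x\<in>carrier R. \<eta> (Tr (e k \<otimes> x)) * \<eta> (Tr (e l \<otimes> x)))
      = (\<Sum>x\<in>carrier R - {\<zero>}. \<eta> (Tr (e k \<otimes> x)) * \<eta> (Tr (e l \<otimes> x)))"
    using finite_R by (simp add: sum.remove[of "carrier R" \<zero>])
  also have "\<dots> = (\<Sum>j<N. \<eta> (Tr (e k \<otimes> e j)) * \<eta> (Tr (e l \<otimes> e j)))"
    by (rule sum.reindex_bij_betw[OF e_bij, symmetric])
  also have "\<dots> = (\<Sum>j<N. ?P j)"
    by (simp only: c_def e_add[symmetric] add.commute)
  also have "\<dots> = (\<Sum>t<q - 1. \<Sum>r<q+1. ?P r)"
    unfolding N_def sum_lessThan_mult shift ..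
  finally show ?thesis using q_gt by (simp add: of_nat_diff)
qed

text \<open>Antiperiodicity holds as \<open>e (q + 1)\<close> is a nonsquare of \<open>F\<close>,
  invariance as conjugation preserves the trace, orthogonality as traces are independent and
  \<open>\<eta>\<close> has sum 0.\<close>

sublocale octic_conference q c
proof
  show "q mod 8 = 3" using q_eq by simp
  show anti: "c (k + (q + 1)) = - c k" for k
  proof -
    have "e (k + (q + 1)) = z 1 \<otimes> e k" unfolding z_def e_add[symmetric] by (simp add: add.commute)
    then show ?thesis using \<eta>_z[of 1] by (simp add: c_def Tr_scale \<eta>_mult)
  qed
  show "c (q * k) = c k" for k
  proof -
    have "q * k * q = k + N * k" using q_gt by (simp add: N_eq power2_eq_square algebra_simps)
    then have "e (q * k * q) = e k" by (simp add: e_eq_iff cong_def)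
    moreover have "e k [^] q = e (q * k)" by (simp add: e_pow mult.commute)
    ultimately have "Tr (e (q * k)) = Tr (e k)" using a_comm[of "e (q * k)" "e k"] by (simp add: Tr_def e_pow)
    then show ?thesis by (simp add: c_def)
  qed
  show "(\<Sum>j<q+1. c (j + k) * c (j + l)) = 0" if "\<not> [k = l] (mod (q + 1))" for k l
    using sum_products_c[OF anti, of k l] sum_trace_pair[OF that, of \<eta> \<eta>] q_gt by (simp add: sum_\<eta>)
  show "(\<Sum>j<q+1. c (j + k) * c (j + k)) = real q" for k
    using sum_products_c[OF anti, of k k] sum_trace[of "\<lambda>t. \<eta> t * \<eta> t" k] q_gt
    by (simp add: sum_\<eta>_square del: sum.lessThan_Suc)
qed

section \<open>Ridge functions and their autocorrelation\<close>

definition profile :: "(nat \<Rightarrow> real) \<Rightarrow> (nat \<Rightarrow> real) \<Rightarrow> nat \<Rightarrow> 'a \<Rightarrow> real" where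
  "profile \<alpha> \<beta> j t = \<alpha> j * of_bool (t = \<zero>) + \<beta> j * \<eta> t"

definition ridge :: "(nat \<Rightarrow> real) \<Rightarrow> (nat \<Rightarrow> real) \<Rightarrow> 'a \<Rightarrow> real" where
  "ridge \<alpha> \<beta> x = (\<Sum>j<q+1. profile \<alpha> \<beta> j (Tr (e j \<otimes> x)))"

lemma sum_profile: "(\<Sum>t\<in>F. profile \<alpha> \<beta> j t) = \<alpha> j"
  unfolding profile_def sum.distrib sum_distrib_left[symmetric] sum_\<eta>
  using finite_F by (simp add: of_bool_def)

text \<open>The mixed terms contain \<open>\<eta> s\<close> and \<open>\<eta> (\<ominus> s)\<close>
  and cancel because the character is odd.\<close>

lemma profile_autocorrelation:
  assumes s: "s \<in> F"
  shows "(\<Sum>t\<in>F. profile \<alpha> \<beta> j t * profile \<alpha> \<beta> j (t \<oplus> s))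
    = (if s = \<zero> then (\<alpha> j)\<^sup>2 + (real q - 1) * (\<beta> j)\<^sup>2 else - (\<beta> j)\<^sup>2)"
proof -
  have minus: "t \<oplus> s = \<zero> \<longleftrightarrow> t = \<ominus> s" if "t \<in> F" for t
    using that s minus_equality[of t s] by (auto simp: l_neg)
  have "(\<Sum>t\<in>F. profile \<alpha> \<beta> j t * profile \<alpha> \<beta> j (t \<oplus> s))
     = (\<Sum>t\<in>F. (if t = \<zero> then (\<alpha> j)\<^sup>2 * of_bool (s = \<zero>) + \<alpha> j * \<beta> j * \<eta> s else 0)
         + (if t = \<ominus> s then \<alpha> j * \<beta> j * \<eta> (\<ominus> s) else 0) + (\<beta> j)\<^sup>2 * (\<eta> t * \<eta> (t \<oplus> s)))"
    using s by (intro sum.cong refl) (auto simp: profile_def minus power2_eq_square algebra_simps)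
  also have "\<dots> = (\<alpha> j)\<^sup>2 * of_bool (s = \<zero>) + \<alpha> j * \<beta> j * \<eta> s + \<alpha> j * \<beta> j * \<eta> (\<ominus> s)
      + (\<beta> j)\<^sup>2 * (\<Sum>t\<in>F. \<eta> t * \<eta> (t \<oplus> s))"
    using finite_F s by (simp add: sum.distrib sum_distrib_left)
  also have "(\<Sum>t\<in>F. \<eta> t * \<eta> (t \<oplus> s)) = (if s = \<zero> then real q - 1 else -1)"
    using s \<eta>_autocorrelation sum_\<eta>_square by (simp cong: sum.cong)
  finally show ?thesis using s by (simp add: \<eta>_minus)
qed

lemma Tr_e_eq_zero_iff_index:
  assumes j0: "j0 < q + 1" "[j0 + k = 4 * m + 2] (mod (q + 1))" and j: "j < q + 1"
  shows "Tr (e (j + k)) = \<zero> \<longleftrightarrow> j = j0"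
proof -
  have "Tr (e (j + k)) = \<zero> \<longleftrightarrow> [j + k = j0 + k] (mod (q + 1))"
    unfolding Tr_e_eq_zero_iff using j0(2) cong_trans cong_sym by blast
  also have "\<dots> \<longleftrightarrow> [j = j0] (mod (q + 1))" by (simp only: cong_add_rcancel_nat)
  also have "\<dots> \<longleftrightarrow> j = j0" using j j0(1) by (simp add: cong_def)
  finally show ?thesis .
qed

text \<open>Distinct directions contribute only \<open>\<alpha> i * \<alpha> j\<close>. The shift
  \<open>e k\<close> enters through the energy of the one direction \<open>j0\<close> in which its
  trace is zero, so equal energies give a constant.\<close>

lemma ridge_autocorrelation:
  assumes j0: "j0 < q + 1" "[j0 + k = 4 * m + 2] (mod (q + 1))"
  shows "(\<Sum>x\<in>carrier R. ridge \<alpha> \<beta> x * ridge \<alpha> \<beta> (x \<oplus> e k))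
    = (\<Sum>j<q+1. \<alpha> j)\<^sup>2 - (\<Sum>j<q+1. (\<alpha> j)\<^sup>2 + real q * (\<beta> j)\<^sup>2)
      + real q * ((\<alpha> j0)\<^sup>2 + real q * (\<beta> j0)\<^sup>2)"
proof -
  define E where "E j = (\<alpha> j)\<^sup>2 + real q * (\<beta> j)\<^sup>2" for j
  let ?p = "profile \<alpha> \<beta>"
  have incong: "\<not> [i = j] (mod (q + 1))" if "i < q + 1" "j < q + 1" "i \<noteq> j" for i j
    using that by (simp add: cong_def)
  note s_zero = Tr_e_eq_zero_iff_index[OF j0]
  \<comment> \<open>For \<open>i = j\<close> the value is split into
    \<open>(\<alpha> j)\<^sup>2\<close> and a correction, so that the first terms assemble into the
    square of the total.\<close>
  have pair_term: "(\<Sum>x\<in>carrier R. ?p i (Tr (e i \<otimes> x)) * ?p j (Tr (e j \<otimes> x) \<oplus> Tr (e (j + k))))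
      = \<alpha> i * \<alpha> j + (if i = j then (if j = j0 then real q * E j else 0) - E j else 0)"
    if ij: "i < q + 1" "j < q + 1" for i j
  proof (cases "i = j")
    case True
    have "(\<Sum>x\<in>carrier R. ?p j (Tr (e j \<otimes> x)) * ?p j (Tr (e j \<otimes> x) \<oplus> Tr (e (j + k))))
        = real q * (\<Sum>t\<in>F. ?p j t * ?p j (t \<oplus> Tr (e (j + k))))"
      by (rule sum_trace)
    then show ?thesis using True ij
      by (simp add: profile_autocorrelation s_zero E_def power2_eq_square algebra_simps)
  next
    case False
    have "(\<Sum>x\<in>carrier R. ?p i (Tr (e i \<otimes> x)) * ?p j (Tr (e j \<otimes> x) \<oplus> Tr (e (j + k))))
        = (\<Sum>t\<in>F. ?p i t) * (\<Sum>t\<in>F. ?p j (t \<oplus> Tr (e (j + k))))"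
      by (rule sum_trace_pair[OF incong[OF ij False]])
    then show ?thesis using False by (simp add: sum_F_translate[of _ "?p j"] sum_profile)
  qed
  have "(\<Sum>x\<in>carrier R. ridge \<alpha> \<beta> x * ridge \<alpha> \<beta> (x \<oplus> e k))
     = (\<Sum>x\<in>carrier R. \<Sum>i<q+1. \<Sum>j<q+1. ?p i (Tr (e i \<otimes> x)) * ?p j (Tr (e j \<otimes> x) \<oplus> Tr (e (j + k))))"
    unfolding ridge_def sum_product
    by (intro sum.cong refl) (simp add: r_distr Tr_add e_add)
  also have "\<dots> = (\<Sum>i<q+1. \<Sum>j<q+1. \<Sum>x\<in>carrier R. ?p i (Tr (e i \<otimes> x)) * ?p j (Tr (e j \<otimes> x) \<oplus> Tr (e (j + k))))"
    by (subst sum.swap) (intro sum.cong refl sum.swap)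
  also have "\<dots> = (\<Sum>i<q+1. \<Sum>j<q+1. \<alpha> i * \<alpha> j + (if i = j then (if j = j0 then real q * E j else 0) - E j else 0))"
    by (intro sum.cong refl pair_term) (simp_all only: lessThan_iff)
  also have "\<dots> = (\<Sum>j<q+1. \<alpha> j)\<^sup>2 + (\<Sum>i<q+1. (if i = j0 then real q * E i else 0) - E i)"
    unfolding sum.distrib power2_eq_square sum_product
    by (intro arg_cong2[where f = "(+)"] refl sum.cong) (simp del: sum.lessThan_Suc)
  also have "(\<Sum>i<q+1. (if i = j0 then real q * E i else 0) - E i) = real q * E j0 - (\<Sum>i<q+1. E i)"
    unfolding sum_subtractf using j0(1) by (simp only: sum.delta finite_lessThan lessThan_iff if_True)
  finally show ?thesis by (simp add: E_def)
qed

lemma sum_ridge: "(\<Sum>x\<in>carrier R. ridge \<alpha> \<beta> x) = real q * (\<Sum>j<q+1. \<alpha> j)"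
  unfolding ridge_def by (subst sum.swap) (simp only: sum_trace sum_profile sum_distrib_left)

lemma ridge_zero: "ridge \<alpha> \<beta> \<zero> = (\<Sum>j<q+1. \<alpha> j)"
  by (simp add: ridge_def profile_def)

lemma ridge_e:
  assumes j0: "j0 < q + 1" "[j0 + k = 4 * m + 2] (mod (q + 1))"
  shows "ridge \<alpha> \<beta> (e k) = \<alpha> j0 + (\<Sum>j<q+1. \<beta> j * c (j + k))"
proof -
  note Tr_e_eq_zero_iff_index[OF j0]
  then have "(\<Sum>j<q+1. \<alpha> j * of_bool (Tr (e (j + k)) = \<zero>)) = (\<Sum>j<q+1. if j = j0 then \<alpha> j0 else 0)"
    by (intro sum.cong refl) (auto simp only: lessThan_iff of_bool_def mult_1_right mult_zero_right split: if_splits)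
  also have "\<dots> = \<alpha> j0" using j0(1) by (simp only: sum.delta finite_lessThan lessThan_iff if_True)
  finally show ?thesis
    by (simp only: ridge_def profile_def e_add[symmetric] sum.distrib c_def)
qed

end

section \<open>The difference family\<close>

context quadratic_extension
begin

section \<open>Coefficients of the difference family\<close>

definition signed :: "real list \<Rightarrow> nat \<Rightarrow> real" where
  "signed A j = (-1) ^ (j div 4) * A ! (j mod 4)"

text \<open>By \<open>g_inversion\<close>, summing these against \<open>c (j + k)\<close> gives half
  of a signed union of the octic classes 0, 4, 2, 6; \<open>shift_coeff r\<close> gives the classes
  \<open>r\<close> and \<open>r + 4\<close> with opposite signs.\<close>

definition pair_coeff :: "real \<Rightarrow> nat \<Rightarrow> real" where
  "pair_coeff s j = (g j + s * g (j + 2)) / (2 * real q)"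

definition shift_coeff :: "nat \<Rightarrow> nat \<Rightarrow> real" where
  "shift_coeff r j = g (j + r) / real q"

text \<open>The signs in \<open>signed\<close> only serve to make the coefficients add up to the right totals, by
  \<open>sum_signed\<close>; the energies do not depend on them. The four-periodic patterns come from a computer
  search over all ways to distribute the lines among \<open>u\<^sub>i\<close> and \<open>w\<^sub>i\<close> such that the energies are constant
  and \<open>u\<^sub>i\<close>, \<open>w\<^sub>i\<close> have complementary supports.\<close>

definition w :: "nat \<Rightarrow> 'a \<Rightarrow> real" where
  "w i x = [ridge (signed [1/2, 1, -1/2, 0]) (pair_coeff (-1)) x,
            ridge (signed [1/2, 1, 1/2, -1]) (pair_coeff (-1)) x,
            of_bool (x = \<zero>),
            ridge (signed [1, 0, -1, 0]) (shift_coeff 1) x] ! i"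

definition u :: "nat \<Rightarrow> 'a \<Rightarrow> real" where
  "u i x = [ridge (signed [1/2, 0, 1/2, -1]) (pair_coeff 1) x,
            ridge (signed [1/2, 0, -1/2, 0]) (pair_coeff 1) x,
            ridge (signed [1, 1, -1, -1]) (\<lambda>_. 0) x,
            ridge (\<lambda>_. 0) (shift_coeff 3) x + of_bool (x = \<zero>)] ! i"

text \<open>There is an odd number of blocks of four with alternating signs, so all but one
  cancel.\<close>

lemma sum_signed: "(\<Sum>j<q+1. signed [a0, a1, a2, a3] j) = a0 + a1 + a2 + a3"
proof -
  have q1: "q + 1 = 4 * (2 * m + 1)" using q_eq by simp
  have "(\<Sum>r<4. signed [a0, a1, a2, a3] (r + 4 * t)) = (-1) ^ t * (a0 + a1 + a2 + a3)" for t
    by (simp add: signed_def lessThan_nat_numeral algebra_simps)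
  then have "(\<Sum>j<q+1. signed [a0, a1, a2, a3] j) = (\<Sum>t<2 * m + 1. (-1) ^ t) * (a0 + a1 + a2 + a3)"
    unfolding q1 sum_lessThan_mult by (simp only: sum_distrib_right)
  also have "(\<Sum>t<2 * m + 1. (-1) ^ t) = (1::real)" by (induction m) simp_all
  finally show ?thesis by simp
qed

lemmas sum_signed_Suc = sum_signed[unfolded Suc_eq_plus1[symmetric]]

lemma signed_square: "(signed A j)\<^sup>2 = (A ! (j mod 4))\<^sup>2"
  by (simp add: signed_def power_mult_distrib flip: power_mult)

lemma mod8_range: "(k::nat) mod 8 \<in> {0, 1, 2, 3, 4, 5, 6, 7}"
  using mod_less_divisor[of 8 k] by auto

text \<open>Continues \<open>a, b, 0, b\<close> antiperiodically to a table over the residues modulo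
  8, which turns later claims into finite checks.\<close>

lemma g_add_eq_nth: "g (j + r) = [g 0, g 1, 0, g 1, - g 0, - g 1, 0, - g 1] ! ((j mod 8 + r) mod 8)"
proof -
  have g47: "g 4 = - g 0" "g 5 = - g 1" "g 6 = 0" "g 7 = - g 1"
    using g_add4[of 0] g_add4[of 1] g_add4[of 2] g_add4[of 3] g_2 g_3 by simp_all
  define s where "s = (j + r) mod 8"
  have s: "(j + r) mod 8 = s" "s \<in> {0, 1, 2, 3, 4, 5, 6, 7}"
    using mod8_range[of "j + r"] by (simp_all only: s_def)
  have "g (j + r) = g s" using g_mod8[of "j + r"] by (simp only: s)
  then show ?thesis
    unfolding mod_add_left_eq s(1) using s(2) g_2 g_3 g47 by (elim insertE) simp_all
qed

lemma octic_sign_add_eq_nth: "octic_sign (k + r) = [1, 0, 0, 0, -1, 0, 0, 0] ! ((k mod 8 + r) mod 8)"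
proof -
  define s where "s = (k + r) mod 8"
  have s: "(k + r) mod 8 = s" "s \<in> {0, 1, 2, 3, 4, 5, 6, 7}"
    using mod8_range[of "k + r"] by (simp_all only: s_def)
  have "octic_sign (k + r) = octic_sign s" using octic_sign_mod8[of "k + r"] s(1) by simp
  then show ?thesis
    unfolding mod_add_left_eq s(1) using s(2) by (elim insertE) (simp_all add: octic_sign_def)
qed

lemma mod4_of_mod8: "(k::nat) mod 4 = k mod 8 mod 4"
  by (simp add: mod_mod_cancel)

lemma divide_by_q: "2 * a + b = real q * y \<Longrightarrow> 2 * (a / real q) + b / real q = y"
  using q_gt by (simp add: field_simps)

lemma energy:
  "real q * (pair_coeff s j)\<^sup>2 = ((g j + s * g (j + 2)) / 2)\<^sup>2 / real q" "real q * (shift_coeff r j)\<^sup>2 = (g (j + r))\<^sup>2 / real q"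
  using q_gt by (simp_all add: pair_coeff_def shift_coeff_def power2_eq_square field_simps)

text \<open>By \<open>g_squares\<close> the odd parts have energy 1/2, 0, 1/2, 1 for
  \<open>j mod 4\<close> = 0, 1, 2, 3; the squared patterns supply the rest up to 2.\<close>

lemma energy_w:
  "((signed [1/2, 1, -1/2, 0] j)\<^sup>2 + real q * (pair_coeff (-1) j)\<^sup>2) + ((signed [1/2, 1, 1/2, -1] j)\<^sup>2 + real q * (pair_coeff (-1) j)\<^sup>2)
    + ((signed [1, 0, -1, 0] j)\<^sup>2 + real q * (shift_coeff 1 j)\<^sup>2) = 2"
proof -
  define a b where ab: "a = g 0" "b = g 1"
  define s where "s = j mod 8"
  have s: "j mod 8 = s" "s \<in> {0, 1, 2, 3, 4, 5, 6, 7}"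
    using mod8_range[of "j"] by (simp_all only: s_def)
  note nth = g_add_eq_nth[of j, folded ab, unfolded s(1)]
  have "2 * ((g j + -1 * g (j + 2)) / 2)\<^sup>2 + (g (j + 1))\<^sup>2 = real q * [1/2, 0, 1/2, 1] ! (s mod 4)"
    unfolding g_squares[folded ab, symmetric] nth[of 2] nth[of 1] nth[of 0, unfolded add_0_right]
    using s(2) by (elim insertE) (simp_all add: power2_eq_square field_simps)
  then have "2 * (((g j + -1 * g (j + 2)) / 2)\<^sup>2 / real q) + (g (j + 1))\<^sup>2 / real q = [1/2, 0, 1/2, 1] ! (s mod 4)"
    by (rule divide_by_q)
  moreover have "(signed [1/2, 1, -1/2, 0] j)\<^sup>2 + (signed [1/2, 1, 1/2, -1] j)\<^sup>2 + (signed [1, 0, -1, 0] j)\<^sup>2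
      = 2 - [1/2, 0, 1/2, 1] ! (s mod 4)"
    unfolding signed_square mod4_of_mod8[of j] s(1)
    using s(2) by (elim insertE) (simp_all add: power2_eq_square)
  ultimately show ?thesis unfolding energy by linarith
qed

text \<open>The same balance as for \<open>w\<close>, with odd energies 1/2, 1, 1/2, 0.\<close>

lemma energy_u:
  "((signed [1/2, 0, 1/2, -1] j)\<^sup>2 + real q * (pair_coeff 1 j)\<^sup>2) + ((signed [1/2, 0, -1/2, 0] j)\<^sup>2 + real q * (pair_coeff 1 j)\<^sup>2)
    + ((signed [1, 1, -1, -1] j)\<^sup>2 + real q * 0\<^sup>2) + (0\<^sup>2 + real q * (shift_coeff 3 j)\<^sup>2) = 2"
proof -
  define a b where ab: "a = g 0" "b = g 1"
  define s where "s = j mod 8"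
  have s: "j mod 8 = s" "s \<in> {0, 1, 2, 3, 4, 5, 6, 7}"
    using mod8_range[of "j"] by (simp_all only: s_def)
  note nth = g_add_eq_nth[of j, folded ab, unfolded s(1)]
  have "2 * ((g j + 1 * g (j + 2)) / 2)\<^sup>2 + (g (j + 3))\<^sup>2 = real q * [1/2, 1, 1/2, 0] ! (s mod 4)"
    unfolding g_squares[folded ab, symmetric] nth[of 2] nth[of 3] nth[of 0, unfolded add_0_right]
    using s(2) by (elim insertE) (simp_all add: power2_eq_square field_simps)
  then have "2 * (((g j + 1 * g (j + 2)) / 2)\<^sup>2 / real q) + (g (j + 3))\<^sup>2 / real q = [1/2, 1, 1/2, 0] ! (s mod 4)"
    by (rule divide_by_q)
  moreover have "(signed [1/2, 0, 1/2, -1] j)\<^sup>2 + (signed [1/2, 0, -1/2, 0] j)\<^sup>2 + (signed [1, 1, -1, -1] j)\<^sup>2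
      = 2 - [1/2, 1, 1/2, 0] ! (s mod 4)"
    unfolding signed_square mod4_of_mod8[of j] s(1)
    using s(2) by (elim insertE) (simp_all add: power2_eq_square)
  ultimately show ?thesis unfolding energy by simp
qed

text \<open>As \<open>q\<close> is -1 modulo \<open>q + 1\<close>, this is
  \<open>4 * m + 2 - k\<close>: the direction in which the trace of \<open>e k\<close>
  vanishes.\<close>

definition dual :: "nat \<Rightarrow> nat" where "dual k = (4 * m + 2 + q * k) mod (q + 1)"

lemma dual_less: "dual k < q + 1"
  unfolding dual_def by (rule mod_less_divisor) simp

lemma dual_cong: "[dual k + k = 4 * m + 2] (mod (q + 1))"
proof -
  have "[dual k + k = 4 * m + 2 + q * k + k] (mod (q + 1))"
    unfolding dual_def cong_def by (rule mod_add_left_eq)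
  also have "4 * m + 2 + q * k + k = 4 * m + 2 + (q + 1) * k" by simp
  also have "[\<dots> = 4 * m + 2] (mod (q + 1))" unfolding cong_def by (rule mod_mult_self2)
  finally show ?thesis .
qed

lemma dual_mod4: "dual k mod 4 = (2 + 3 * (k mod 8)) mod 4"
proof -
  have "4 dvd q + 1" using q_eq by simp
  then have "dual k mod 4 = (4 * m + 2 + q * k) mod 4" unfolding dual_def by (rule mod_mod_cancel)
  also have "4 * m + 2 + q * k = 2 + 3 * k + 4 * (m + 2 * m * k)" by (simp add: q_eq algebra_simps)
  also have "\<dots> mod 4 = (2 + 3 * k) mod 4" by (rule mod_mult_self2)
  also have "\<dots> = (2 + 3 * (k mod 8)) mod 4"
    by (metis mod4_of_mod8 mod_add_right_eq mod_mult_right_eq)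
  finally show ?thesis .
qed

lemma sum_pair_coeff: "(\<Sum>j<q+1. pair_coeff s j * c (j + k)) = (octic_sign k + s * octic_sign (k + 14)) / 2"
proof -
  have "(\<Sum>j<q+1. pair_coeff s j * c (j + k))
      = ((\<Sum>j<q+1. g (j + 0) * c (j + k)) + s * (\<Sum>j<q+1. g (j + 2) * c (j + k))) / (2 * real q)"
    unfolding pair_coeff_def sum_distrib_left sum.distrib[symmetric] sum_divide_distrib
    by (intro sum.cong refl) (simp add: field_simps)
  moreover have "(real q * a + s * (real q * b)) / (2 * real q) = (a + s * b) / 2" for a b
    using q_gt by (simp add: field_simps)
  ultimately have "(\<Sum>j<q+1. pair_coeff s j * c (j + k)) = (octic_sign (k + 7 * 0) + s * octic_sign (k + 7 * 2)) / 2"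
    by (simp only: g_inversion)
  then show ?thesis by (simp del: sum.lessThan_Suc)
qed

lemma sum_shift_coeff: "(\<Sum>j<q+1. shift_coeff r j * c (j + k)) = octic_sign (k + 7 * r)"
proof -
  have "(\<Sum>j<q+1. shift_coeff r j * c (j + k)) = (\<Sum>j<q+1. g (j + r) * c (j + k)) / real q"
    unfolding shift_coeff_def sum_divide_distrib by (intro sum.cong refl) simp
  then show ?thesis unfolding g_inversion using q_gt by simp
qed

text \<open>Away from 0 only \<open>k mod 8\<close> and one sign matter. For \<open>i < 2\<close>
  and even \<open>k\<close>, the halves from line and octic class add up to a sign in one of
  \<open>u\<close>, \<open>w\<close> and cancel in the other; otherwise one is a single sign and the
  other 0.\<close>

lemma u_w_disjoint:
  assumes x: "x \<in> carrier R" and i: "i < 4"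
  shows "u i x = 0 \<and> \<bar>w i x\<bar> = 1 \<or> w i x = 0 \<and> \<bar>u i x\<bar> = 1"
proof (cases "x = \<zero>")
  case True
  have "i \<in> {0, 1, 2, 3}" using i by auto
  then show ?thesis
    unfolding True u_def w_def ridge_zero sum_signed by (elim insertE) simp_all
next
  case False
  then obtain k where k: "x = e k" using x nonzero_cases by blast
  have i4: "i \<in> {0, 1, 2, 3}" using i by auto
  define s where "s = k mod 8"
  have s: "k mod 8 = s" "s \<in> {0, 1, 2, 3, 4, 5, 6, 7}"
    using mod8_range[of "k"] by (simp_all only: s_def)
  define \<tau> where "\<tau> = (-1 :: real) ^ (dual k div 4)"
  have \<tau>: "\<tau> = 1 \<or> \<tau> = -1" unfolding \<tau>_def by (cases "even (dual k div 4)") simp_all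
  have signed: "signed A (dual k) = \<tau> * A ! ((2 + 3 * s) mod 4)" for A
    unfolding signed_def dual_mod4 s(1) \<tau>_def ..
  note os = octic_sign_add_eq_nth[of k, unfolded s(1)]
  show ?thesis
    unfolding k u_def w_def ridge_e[OF dual_less dual_cong] signed sum_pair_coeff sum_shift_coeff
      os[of 14] os[of "7 * 1"] os[of "7 * 3"] os[of 0, unfolded add_0_right]
    using s(2) i4 \<tau> by (elim insertE disjE) simp_all
qed

section \<open>Correlations and energies of the family\<close>

lemma correlation_w:
  assumes d: "d \<in> carrier R" "d \<noteq> \<zero>"
  shows "(\<Sum>i<4. \<Sum>x\<in>carrier R. w i x * w i (x \<oplus> d)) = 0"
proof -
  obtain k where k: "d = e k" using d nonzero_cases by blast
  have delta: "(\<Sum>x\<in>carrier R. of_bool (x = \<zero>) * of_bool (x \<oplus> d = \<zero>)) = (0::real)"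
    using d by (intro sum.neutral) auto
  note corr = ridge_autocorrelation[OF dual_less dual_cong, where k = k, folded k]
  define E where "E \<alpha> \<beta> j = (\<alpha> j)\<^sup>2 + real q * (\<beta> j)\<^sup>2" for \<alpha> \<beta> :: "nat \<Rightarrow> real" and j
  let ?E0 = "E (signed [1/2, 1, -1/2, 0]) (pair_coeff (-1))" and ?E1 = "E (signed [1/2, 1, 1/2, -1]) (pair_coeff (-1))"
    and ?E3 = "E (signed [1, 0, -1, 0]) (shift_coeff 1)"
  have energy: "?E0 j + ?E1 j + ?E3 j = 2" for j unfolding E_def by (rule energy_w)
  \<comment> \<open>The coefficient totals 1, 1, 0 have square sum 2 and the indicator
    \<open>w 2\<close> contributes 0, which leaves \<open>2 - 2 (q + 1) + 2 q\<close>.\<close>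
  have "(\<Sum>i<4. \<Sum>x\<in>carrier R. w i x * w i (x \<oplus> d))
      = 2 - ((\<Sum>j<q+1. ?E0 j) + (\<Sum>j<q+1. ?E1 j) + (\<Sum>j<q+1. ?E3 j))
        + real q * (?E0 (dual k) + ?E1 (dual k) + ?E3 (dual k))"
    unfolding w_def
    by (simp add: lessThan_nat_numeral delta corr sum_signed_Suc E_def distrib_left del: sum.lessThan_Suc)
  also have "\<dots> = 0" unfolding sum.distrib[symmetric] energy by simp
  finally show ?thesis .
qed

lemma ridge_odd: assumes "x \<in> carrier R" shows "ridge (\<lambda>_. 0) \<beta> (\<ominus> x) = - ridge (\<lambda>_. 0) \<beta> x"
proof -
  have "Tr (e j \<otimes> \<ominus> x) = \<ominus> Tr (e j \<otimes> x)" for j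
  proof (rule minus_equality[symmetric])
    show "Tr (e j \<otimes> \<ominus> x) \<oplus> Tr (e j \<otimes> x) = \<zero>"
      using assms by (simp add: r_minus l_neg flip: Tr_add)
  qed (use assms in auto)
  then show ?thesis
    using assms by (simp add: ridge_def profile_def \<eta>_minus sum_negf del: sum.lessThan_Suc)
qed

lemma correlation_u:
  assumes d: "d \<in> carrier R" "d \<noteq> \<zero>"
  shows "(\<Sum>i<4. \<Sum>x\<in>carrier R. u i x * u i (x \<oplus> d)) = -2"
proof -
  obtain k where k: "d = e k" using d nonzero_cases by blast
  let ?f = "ridge (\<lambda>_. 0) (shift_coeff 3)"
  have minus: "x \<oplus> d = \<zero> \<longleftrightarrow> x = \<ominus> d" if "x \<in> carrier R" for x
    using that d minus_equality[of x d] by (auto simp: l_neg)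
  \<comment> \<open>The indicator in \<open>u 3\<close> adds \<open>?f d + ?f (\<ominus> d)\<close>,
    which is 0 because \<open>?f\<close> is odd.\<close>
  have "(\<Sum>x\<in>carrier R. (?f x + of_bool (x = \<zero>)) * (?f (x \<oplus> d) + of_bool (x \<oplus> d = \<zero>)))
     = (\<Sum>x\<in>carrier R. ?f x * ?f (x \<oplus> d) + (if x = \<zero> then ?f d else 0) + (if x = \<ominus> d then ?f (\<ominus> d) else 0))"
    using d by (intro sum.cong refl) (auto simp: minus algebra_simps l_neg)
  also have "\<dots> = (\<Sum>x\<in>carrier R. ?f x * ?f (x \<oplus> d))"
    using finite_R d by (simp add: sum.distrib ridge_odd)
  finally have delta: "(\<Sum>x\<in>carrier R. (?f x + of_bool (x = \<zero>)) * (?f (x \<oplus> d) + of_bool (x \<oplus> d = \<zero>)))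
     = (\<Sum>x\<in>carrier R. ?f x * ?f (x \<oplus> d))" .
  note corr = ridge_autocorrelation[OF dual_less dual_cong, where k = k, folded k]
  define E where "E \<alpha> \<beta> j = (\<alpha> j)\<^sup>2 + real q * (\<beta> j)\<^sup>2" for \<alpha> \<beta> :: "nat \<Rightarrow> real" and j
  let ?E0 = "E (signed [1/2, 0, 1/2, -1]) (pair_coeff 1)" and ?E1 = "E (signed [1/2, 0, -1/2, 0]) (pair_coeff 1)"
    and ?E2 = "E (signed [1, 1, -1, -1]) (\<lambda>_. 0)" and ?E3 = "E (\<lambda>_. 0) (shift_coeff 3)"
  have energy: "?E0 j + ?E1 j + ?E2 j + ?E3 j = 2" for j unfolding E_def by (rule energy_u)
  have "(\<Sum>x\<in>carrier R. u 3 x * u 3 (x \<oplus> d)) = - (\<Sum>j<q+1. ?E3 j) + real q * ?E3 (dual k)"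
    using delta corr[of "\<lambda>_. 0" "shift_coeff 3"] by (simp add: u_def E_def)
  \<comment> \<open>All coefficient totals are 0 here, so the result is
    \<open>- 2 (q + 1) + 2 q\<close>.\<close>
  then have "(\<Sum>i<4. \<Sum>x\<in>carrier R. u i x * u i (x \<oplus> d))
      = - ((\<Sum>j<q+1. ?E0 j) + (\<Sum>j<q+1. ?E1 j) + (\<Sum>j<q+1. ?E2 j) + (\<Sum>j<q+1. ?E3 j))
        + real q * (?E0 (dual k) + ?E1 (dual k) + ?E2 (dual k) + ?E3 (dual k))"
    by (simp add: lessThan_nat_numeral del: sum.lessThan_Suc)
       (simp add: u_def corr sum_signed_Suc E_def distrib_left del: sum.lessThan_Suc)
  also have "\<dots> = -2" unfolding sum.distrib[symmetric] energy by simp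
  finally show ?thesis .
qed

lemma sum_u: assumes "i < 4" shows "(\<Sum>x\<in>carrier R. u i x) = (if i = 3 then 1 else 0)"
proof -
  have "i \<in> {0, 1, 2, 3}" using assms by auto
  then show ?thesis
    unfolding u_def using finite_R by (elim insertE) (simp_all add: sum.distrib sum_ridge sum_signed_Suc del: sum.lessThan_Suc)
qed

text \<open>Over all \<open>d\<close> the correlations add up to the sum of the squared totals,
  which is 1; removing \<open>q^2 - 1\<close> values -2 isolates the one at
  \<open>d = 0\<close>.\<close>

lemma sum_squares_u: "(\<Sum>i<4. \<Sum>x\<in>carrier R. (u i x)\<^sup>2) = 2 * (real q)\<^sup>2 - 1"
proof -
  have "(\<Sum>d\<in>carrier R. \<Sum>i<4. \<Sum>x\<in>carrier R. u i x * u i (x \<oplus> d))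
      = (\<Sum>i<4. \<Sum>x\<in>carrier R. u i x * (\<Sum>d\<in>carrier R. u i (x \<oplus> d)))"
    unfolding sum_distrib_left by (subst sum.swap) (intro sum.cong refl sum.swap)
  also have "\<dots> = (\<Sum>i<4. \<Sum>x\<in>carrier R. u i x * (\<Sum>d\<in>carrier R. u i d))"
  proof -
    have "(\<Sum>d\<in>carrier R. u i (x \<oplus> d)) = (\<Sum>d\<in>carrier R. u i d)" if "x \<in> carrier R" for i x
      by (rule sum.reindex_bij_witness[of _ "\<lambda>d. \<ominus> x \<oplus> d" "\<lambda>d. x \<oplus> d"])
         (use that in \<open>auto simp: a_assoc[symmetric] l_neg r_neg\<close>)
    then show ?thesis by (simp cong: sum.cong)
  qed
  also have "\<dots> = 1"
    by (simp add: sum_u sum_distrib_right[symmetric] lessThan_nat_numeral)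
  finally have "(\<Sum>i<4. \<Sum>x\<in>carrier R. u i x * u i (x \<oplus> \<zero>))
      + (\<Sum>d\<in>carrier R - {\<zero>}. \<Sum>i<4. \<Sum>x\<in>carrier R. u i x * u i (x \<oplus> d)) = 1"
    using finite_R by (simp add: sum.remove[of "carrier R" \<zero>])
  moreover have "(\<Sum>d\<in>carrier R - {\<zero>}. \<Sum>i<4. \<Sum>x\<in>carrier R. u i x * u i (x \<oplus> d))
      = (\<Sum>d\<in>carrier R - {\<zero>}. -2)"
    by (intro sum.cong refl correlation_u) auto
  moreover have "real N = (real q)\<^sup>2 - 1" using q_gt by (simp add: N_eq of_nat_diff)
  ultimately show ?thesis
    using card_units by (simp add: power2_eq_square cong: sum.cong)
qed

text \<open>By the complementary supports, the squares of \<open>u\<close> and \<open>w\<close>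
  together add up to \<open>4 q^2\<close>.\<close>

lemma sum_squares_w: "(\<Sum>i<4. \<Sum>x\<in>carrier R. (w i x)\<^sup>2) = 2 * (real q)\<^sup>2 + 1"
proof -
  have "(u i x)\<^sup>2 + (w i x)\<^sup>2 = 1" if "i < 4" "x \<in> carrier R" for i x
    using u_w_disjoint[OF that(2,1)] by (auto simp: power2_eq_1_iff)
  then have "(\<Sum>i<4. \<Sum>x\<in>carrier R. (u i x)\<^sup>2 + (w i x)\<^sup>2) = (\<Sum>i<4::nat. \<Sum>x\<in>carrier R. 1)"
    by (intro sum.cong refl) simp
  then show ?thesis using sum_squares_u card_R by (simp add: sum.distrib)
qed

theorem hadamard_matrix_exists: "\<exists>H. hadamard_matrix (4 * (2 * q\<^sup>2 + 1)) H"
proof -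
  \<comment> \<open>\<open>bool\<close> with inequality as addition is the group of order 2.\<close>
  define G :: "(bool \<times> 'a) monoid" where
    "G = \<lparr>carrier = UNIV \<times> carrier R, mult = (\<lambda>s t. (fst s \<noteq> fst t, snd s \<oplus> snd t)), one = (False, \<zero>)\<rparr>"
  have G_simps: "carrier G = UNIV \<times> carrier R" "\<one>\<^bsub>G\<^esub> = (False, \<zero>)"
    "(b, x) \<otimes>\<^bsub>G\<^esub> (b', y) = (b \<noteq> b', x \<oplus> y)" for b b' x y
    by (simp_all add: G_def)
  interpret G: comm_group G
  proof (rule comm_groupI)
    fix s assume "s \<in> carrier G"
    then show "\<exists>t\<in>carrier G. t \<otimes>\<^bsub>G\<^esub> s = \<one>\<^bsub>G\<^esub>"
      by (intro bexI[of _ "(fst s, \<ominus> snd s)"]) (auto simp: G_def l_neg)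
  qed (auto simp: G_def a_ac)
  define sg where "sg b = (if b then -1 else 1 :: real)" for b
  \<comment> \<open>By \<open>u_w_disjoint\<close> the sums \<open>u i + w i\<close> and
    \<open>u i - w i\<close> are signs on the field, so the integer-valued \<open>f\<close> agrees
    with them there.\<close>
  define f where "f i s = (if u i (snd s) + sg (fst s) * w i (snd s) = 1 then 1 else -1 :: int)" for i s
  have f: "real_of_int (f i (b, x)) = u i x + sg b * w i x" if "i < 4" "x \<in> carrier R" for i b x
    using u_w_disjoint[OF that(2,1)] by (auto simp: f_def sg_def)
  have sum_G: "(\<Sum>s\<in>carrier G. h s) = (\<Sum>x\<in>carrier R. h (False, x) + h (True, x))" for h :: "bool \<times> 'a \<Rightarrow> real"
    unfolding G_simps by (simp add: sum.cartesian_product[symmetric, where g = "\<lambda>a b. h (a, b)", simplified] UNIV_bool sum.distrib)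
  \<comment> \<open>Adding over both copies of the field cancels the products of \<open>u i\<close>
    with \<open>w i\<close>.\<close>
  have auto: "real_of_int (autocorrelation G (f i) (b, d))
      = 2 * (\<Sum>x\<in>carrier R. u i x * u i (x \<oplus> d)) + 2 * sg b * (\<Sum>x\<in>carrier R. w i x * w i (x \<oplus> d))"
    if i: "i < 4" and d: "d \<in> carrier R" for i b d
  proof -
    have "real_of_int (autocorrelation G (f i) (b, d))
        = (\<Sum>s\<in>carrier G. real_of_int (f i s) * real_of_int (f i (s \<otimes>\<^bsub>G\<^esub> (b, d))))"
      by (simp add: autocorrelation_def)
    also have "\<dots> = (\<Sum>x\<in>carrier R. 2 * (u i x * u i (x \<oplus> d)) + 2 * sg b * (w i x * w i (x \<oplus> d)))"
      unfolding sum_G using i d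
      by (intro sum.cong refl) (simp add: G_simps f, simp add: sg_def algebra_simps)
    finally show ?thesis by (simp add: sum.distrib sum_distrib_left)
  qed
  have sums: "(\<Sum>s\<in>carrier G. f i s) = (if i = 3 then 2 else 0)" if i: "i < 4" for i
  proof -
    have "real_of_int (\<Sum>s\<in>carrier G. f i s) = (\<Sum>x\<in>carrier R. 2 * u i x)"
      unfolding of_int_sum sum_G using i by (intro sum.cong refl) (simp add: f sg_def)
    also have "\<dots> = real_of_int (if i = 3 then 2 else 0)"
      using sum_u[OF i] by (simp flip: sum_distrib_left)
    finally show ?thesis by (simp only: of_int_eq_iff)
  qed
  have "\<exists>M. hadamard_matrix (4 * (card (carrier G) + 1)) M"
  proof (rule G.hadamard_matrix_of_four_functions[of "f 3" "f 0" "f 1" "f 2"])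
    show "finite (carrier G)" using finite_R by (simp add: G_simps)
    fix s assume s: "s \<in> carrier G" "s \<noteq> \<one>\<^bsub>G\<^esub>"
    then obtain b d where bd: "s = (b, d)" "d \<in> carrier R" "d \<noteq> \<zero> \<or> b" by (auto simp: G_simps)
    have "real_of_int (autocorrelation G (f 3) s + autocorrelation G (f 0) s
        + autocorrelation G (f 1) s + autocorrelation G (f 2) s)
      = 2 * (\<Sum>i<4. \<Sum>x\<in>carrier R. u i x * u i (x \<oplus> d)) + 2 * sg b * (\<Sum>i<4. \<Sum>x\<in>carrier R. w i x * w i (x \<oplus> d))"
      unfolding bd(1) using bd(2) by (simp add: auto lessThan_nat_numeral algebra_simps)
    \<comment> \<open>For \<open>d = 0\<close> the value is
      \<open>2 (2 q^2 - 1) - 2 (2 q^2 + 1)\<close>, otherwise \<open>2 * (-2) + 0\<close>.\<close>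
    also have "\<dots> = real_of_int (-4)"
    proof (cases "d = \<zero>")
      case True
      then have "b" using bd by simp
      then show ?thesis
        using True sum_squares_u sum_squares_w by (simp add: sg_def power2_eq_square cong: sum.cong)
    next
      case False
      then show ?thesis using correlation_u correlation_w bd by simp
    qed
    finally show "autocorrelation G (f 3) s + autocorrelation G (f 0) s
        + autocorrelation G (f 1) s + autocorrelation G (f 2) s = -4"
      by (simp only: of_int_eq_iff)
  qed (simp_all add: sums, simp_all add: f_def)
  moreover have "card (carrier G) = 2 * q\<^sup>2"
    using card_R by (simp add: G_simps card_cartesian_product)
  ultimately show ?thesis by simp
qed

end

theorem theorem1p3:
  fixes q :: nat and c :: int
  assumes "primepow q"
    and "int q = 12 * c^2 + 4 * c + 3"
  shows "\<exists>H. hadamard_matrix (4 * (2 * q^2 + 1)) H"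
proof -
  \<comment> \<open>\<open>q - 3\<close> is four times a product of two numbers of opposite parity,
    so \<open>q\<close> is 3 modulo 8.\<close>
  have "even (c * (3 * c + 1))" by (cases "even c") auto
  then obtain t where t: "c * (3 * c + 1) = 2 * t" by (elim evenE)
  have "int q = 4 * (c * (3 * c + 1)) + 3"
    using assms(2) by (simp add: power2_eq_square algebra_simps)
  then have "int q mod 8 = 3" unfolding t by presburger
  then have "q mod 8 = 3" by presburger
  then have q_eq: "q = 8 * (q div 8) + 3" by presburger
  obtain p n where p: "Factorial_Ring.prime p" "n > 0" "q = p ^ n"
    using assms(1) by (auto simp: primepow_def)
  \<comment> \<open>The exponent \<open>2 * n\<close> yields \<open>q\<^sup>2\<close> elements;
    Frobenius is then taken with \<open>j = n\<close>, which is the \<open>q\<close>-th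
    power.\<close>
  obtain R :: "((int list \<times> nat) multiset \<Rightarrow> int) ring" where R: "field R" "card (carrier R) = p ^ (2 * n)"
    and frob: "\<And>x y j. x \<in> carrier R \<Longrightarrow> y \<in> carrier R \<Longrightarrow>
      (x \<oplus>\<^bsub>R\<^esub> y) [^]\<^bsub>R\<^esub> (p ^ j) = x [^]\<^bsub>R\<^esub> (p ^ j) \<oplus>\<^bsub>R\<^esub> y [^]\<^bsub>R\<^esub> (p ^ j)"
    using finite_field_exists[OF p(1), of "2 * n"] p(2) by (metis nat_0_less_mult_iff zero_less_numeral)
  interpret R: field R by (rule R(1))
  have card: "card (carrier R) = q\<^sup>2" by (simp add: R(2) p(3) power_mult[symmetric] mult.commute)
  then have "card (carrier R) > 0" using q_eq by simp
  then have "finite (carrier R)" by (rule card_ge_0_finite)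
  then obtain \<omega> where \<omega>: "\<omega> \<in> carrier R - {\<zero>\<^bsub>R\<^esub>}"
      "carrier R - {\<zero>\<^bsub>R\<^esub>} = {\<omega> [^]\<^bsub>R\<^esub> i | i :: nat. True}"
    using R.finite_field_mult_group_has_gen
    by (auto simp: Multiplicative_Group.carrier_mult_of Multiplicative_Group.nat_pow_mult_of)
  interpret quadratic_extension R q "q div 8" \<omega>
    using q_eq card frob[of _ _ n] \<omega> by unfold_locales (simp_all add: p(3))
  show ?thesis by (rule hadamard_matrix_exists)
qed

end
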